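(* For every $m\ge1$, every triad in $\mathbb U_m$ generates a subalgebra isomorphic or anti-isomorphic to one of $\mathbb H$, $\mathbb O$, $\mathbb P_4$, $\mathbb P_{12}$, $\mathbb P_{14}$. Furthermore, up to isomorphism or anti-isomorphism, the algebras generated by triads are: for $\mathbb U_1$, the algebras $\mathbb H$, $\mathbb O$, $\mathbb P_4$; for $\mathbb U_2$, the algebras $\mathbb H$, $\mathbb O$, $\mathbb P_4$, $\mathbb P_{12}$; and for $\mathbb U_m$ with $m\ge3$, the algebras $\mathbb H$, $\mathbb O$, $\mathbb P_4$, $\mathbb P_{12}$, $\mathbb P_{14}$; where in each case every listed algebra does arise from some triad.
   Context: The real algebras $\mathbb A_n$ are defined recursively: $\mathbb A_0=\mathbb R$ with trivial conjugation, and $\mathbb A_n=\mathbb A_{n-1}\oplus\mathbb A_{n-1}$ with $(x,y)(z,w)=(xz-w^*y,\; wx+yz^* )$ and $(x,y)^*=(x^*,-y)$. The graded basis of $\mathbb A_n$ is $\{\mathrm o_\alpha:\alpha\subseteq\{1,\dots,n\}\}$, with $\mathrm o_\emptyset=1$ and, for $\alpha\subseteq\{1,\dots,n-1\}$, $\mathrm o_\alpha=(\mathrm o_\alpha,0)$ and $\mathrm o_{\alpha\cup\{n\}}=(0,\mathrm o_\alpha)$; indices are written as strings, e.g. $\mathrm o_{34}=\mathrm o_{\{3,4\}}$. Pure basis elements are those with $\alpha\ne\emptyset$. The natural order on basis elements is: $\mathrm o_\alpha<\mathrm o_\beta$ iff $\alpha\ne\beta$ and the largest element of the symmetric difference of $\alpha$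 and $\beta$ lies in $\beta$. A triad is a triple $(b,c,d)$ of pure basis elements with $b<c<d$. $\mathbb H=\mathbb A_2$ (quaternions), $\mathbb O=\mathbb A_3$ (octonions), and $\mathbb U_m=\mathbb A_{m+3}$ for $m\ge1$. Quasi-octonion algebras: $\mathbb P_4$ is (up to isomorphism) the subalgebra of $\mathbb U_1$ generated by $\mathrm o_1,\mathrm o_2,\mathrm o_{34}$; $\mathbb P_{12}$ is the subalgebra of $\mathbb U_2$ generated by $\mathrm o_1,\mathrm o_{24},\mathrm o_{345}$; $\mathbb P_{14}$ is the subalgebra of $\mathbb U_3$ generated by $\mathrm o_{14},\mathrm o_{25},\mathrm o_{36}$. *)

theory Defs
  imports Complex_Main
begin

text \<open>
  A single datatype holds the elements of all Cayley-Dickson algebras: the elements of the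
  \<open>n\<close>-th algebra are the complete binary trees of height \<open>n\<close> with real leaves
  (\<open>cd_algebra n\<close> below).  The operations are meant to be applied to two trees of the
  same height; they are unspecified otherwise.
\<close>

datatype cd = Scalar real | Double cd cd

primrec cd_algebra :: "nat \<Rightarrow> cd set" where
  "cd_algebra 0 = range Scalar"
| "cd_algebra (Suc n) = {Double x y | x y. x \<in> cd_algebra n \<and> y \<in> cd_algebra n}"

primrec cd_zero :: "nat \<Rightarrow> cd" where
  "cd_zero 0 = Scalar 0"
| "cd_zero (Suc n) = Double (cd_zero n) (cd_zero n)"

fun cd_add :: "cd \<Rightarrow> cd \<Rightarrow> cd" where
  "cd_add (Scalar a) (Scalar b) = Scalar (a + b)"
| "cd_add (Double x y) (Double z w) = Double (cd_add x z) (cd_add y w)"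

primrec cd_scale :: "real \<Rightarrow> cd \<Rightarrow> cd" where
  "cd_scale r (Scalar a) = Scalar (r * a)"
| "cd_scale r (Double x y) = Double (cd_scale r x) (cd_scale r y)"

definition cd_uminus :: "cd \<Rightarrow> cd" where
  "cd_uminus x = cd_scale (-1) x"

definition cd_minus :: "cd \<Rightarrow> cd \<Rightarrow> cd" where
  "cd_minus x y = cd_add x (cd_uminus y)"

primrec cd_conj :: "cd \<Rightarrow> cd" where
  "cd_conj (Scalar a) = Scalar a"
| "cd_conj (Double x y) = Double (cd_conj x) (cd_uminus y)"

lemma size_cd_scale: "size (cd_scale r x) = size x"
  by (induction x) simp_all

lemma size_cd_conj: "size (cd_conj x) = size x"
  by (induction x) (simp_all add: cd_uminus_def size_cd_scale)

function (sequential) cd_mult :: "cd \<Rightarrow> cd \<Rightarrow> cd" where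
  "cd_mult (Scalar a) (Scalar b) = Scalar (a * b)"
| "cd_mult (Double x y) (Double z w) =
     Double (cd_minus (cd_mult x z) (cd_mult (cd_conj w) y))
          (cd_add (cd_mult w x) (cd_mult y (cd_conj z)))"
  by pat_completeness auto
termination
  by (relation "measure (\<lambda>(x, y). size x + size y)") (auto simp: size_cd_conj)

primrec cd_one :: "nat \<Rightarrow> cd" where
  "cd_one 0 = Scalar 1"
| "cd_one (Suc n) = Double (cd_one n) (cd_zero n)"

text \<open>\<open>cd_basis n \<alpha>\<close> is the graded basis element with index set \<open>\<alpha> \<subseteq> {1..n}\<close>.\<close>

primrec cd_basis :: "nat \<Rightarrow> nat set \<Rightarrow> cd" where
  "cd_basis 0 \<alpha> = cd_one 0"
| "cd_basis (Suc n) \<alpha> =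
     (if Suc n \<in> \<alpha> then Double (cd_zero n) (cd_basis n (\<alpha> - {Suc n}))
      else Double (cd_basis n \<alpha>) (cd_zero n))"

definition cd_pure_basis :: "nat \<Rightarrow> cd set" where
  "cd_pure_basis n = {cd_basis n \<alpha> | \<alpha>. \<alpha> \<subseteq> {1..n} \<and> \<alpha> \<noteq> {}}"

definition index_less :: "nat set \<Rightarrow> nat set \<Rightarrow> bool" where
  "index_less \<alpha> \<beta> \<longleftrightarrow> \<alpha> \<noteq> \<beta> \<and> Max ((\<alpha> - \<beta>) \<union> (\<beta> - \<alpha>)) \<in> \<beta>"

definition cd_basis_less :: "nat \<Rightarrow> cd \<Rightarrow> cd \<Rightarrow> bool" where
  "cd_basis_less n b c \<longleftrightarrow>
     (\<exists>\<alpha> \<beta>. \<alpha> \<subseteq> {1..n} \<and> \<beta> \<subseteq> {1..n} \<and>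
        b = cd_basis n \<alpha> \<and> c = cd_basis n \<beta> \<and> index_less \<alpha> \<beta>)"

definition triad :: "nat \<Rightarrow> cd \<times> cd \<times> cd \<Rightarrow> bool" where
  "triad n = (\<lambda>(b, c, d).
     b \<in> cd_pure_basis n \<and> c \<in> cd_pure_basis n \<and> d \<in> cd_pure_basis n \<and>
     cd_basis_less n b c \<and> cd_basis_less n c d)"

text \<open>
  The unit is not required to lie in a subalgebra.  This makes no difference for subalgebras
  generated by pure basis elements, since these square to minus the unit.
\<close>

definition cd_subalgebra :: "nat \<Rightarrow> cd set \<Rightarrow> bool" where
  "cd_subalgebra n S \<longleftrightarrow>
     S \<subseteq> cd_algebra n \<and> cd_zero n \<in> S \<and>
     (\<forall>x\<in>S. \<forall>y\<in>S. cd_add x y \<in> S) \<and>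
     (\<forall>r. \<forall>x\<in>S. cd_scale r x \<in> S) \<and>
     (\<forall>x\<in>S. \<forall>y\<in>S. cd_mult x y \<in> S)"

definition cd_generated :: "nat \<Rightarrow> cd set \<Rightarrow> cd set" where
  "cd_generated n B = \<Inter> {S. cd_subalgebra n S \<and> B \<subseteq> S}"

definition triad_algebra :: "nat \<Rightarrow> cd \<times> cd \<times> cd \<Rightarrow> cd set" where
  "triad_algebra n = (\<lambda>(b, c, d). cd_generated n {b, c, d})"

definition linear_bijection :: "(cd \<Rightarrow> cd) \<Rightarrow> cd set \<Rightarrow> cd set \<Rightarrow> bool" where
  "linear_bijection f S T \<longleftrightarrow>
     bij_betw f S T \<and>
     (\<forall>x\<in>S. \<forall>y\<in>S. f (cd_add x y) = cd_add (f x) (f y)) \<and>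
     (\<forall>r. \<forall>x\<in>S. f (cd_scale r x) = cd_scale r (f x))"

definition isomorphic :: "cd set \<Rightarrow> cd set \<Rightarrow> bool" where
  "isomorphic S T \<longleftrightarrow>
     (\<exists>f. linear_bijection f S T \<and>
        (\<forall>x\<in>S. \<forall>y\<in>S. f (cd_mult x y) = cd_mult (f x) (f y)))"

definition anti_isomorphic :: "cd set \<Rightarrow> cd set \<Rightarrow> bool" where
  "anti_isomorphic S T \<longleftrightarrow>
     (\<exists>f. linear_bijection f S T \<and>
        (\<forall>x\<in>S. \<forall>y\<in>S. f (cd_mult x y) = cd_mult (f y) (f x)))"

definition alg_H :: "cd set" where "alg_H = cd_algebra 2"

definition alg_O :: "cd set" where "alg_O = cd_algebra 3"

text \<open>The \<open>m\<close>-th algebra \<open>U\<close> is \<open>cd_algebra (U_level m)\<close>, for \<open>m \<ge> 1\<close>.\<close>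

abbreviation U_level :: "nat \<Rightarrow> nat" where "U_level m \<equiv> m + 3"

definition alg_P4 :: "cd set" where
  "alg_P4 = cd_generated (U_level 1)
     {cd_basis (U_level 1) {1}, cd_basis (U_level 1) {2}, cd_basis (U_level 1) {3, 4}}"

definition alg_P12 :: "cd set" where
  "alg_P12 = cd_generated (U_level 2)
     {cd_basis (U_level 2) {1}, cd_basis (U_level 2) {2, 4}, cd_basis (U_level 2) {3, 4, 5}}"

definition alg_P14 :: "cd set" where
  "alg_P14 = cd_generated (U_level 3)
     {cd_basis (U_level 3) {1, 4}, cd_basis (U_level 3) {2, 5}, cd_basis (U_level 3) {3, 6}}"

text \<open>
  The members of \<open>L\<close> are, up to isomorphism or anti-isomorphism, the algebras generated by
  triads at level \<open>n\<close>: each triad generates a listed algebra, and each listed algebra arises.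
\<close>

definition triad_algebras_are :: "nat \<Rightarrow> cd set set \<Rightarrow> bool" where
  "triad_algebras_are n L \<longleftrightarrow>
     (\<forall>t. triad n t \<longrightarrow>
        (\<exists>X\<in>L. isomorphic (triad_algebra n t) X \<or> anti_isomorphic (triad_algebra n t) X)) \<and>
     (\<forall>X\<in>L. \<exists>t. triad n t \<and>
        (isomorphic (triad_algebra n t) X \<or> anti_isomorphic (triad_algebra n t) X))"

end

theory Submission
  imports Defs
begin

text \<open>
  Basis elements multiply up to sign by symmetric difference of their index sets, and any two
  distinct pure ones generate a quaternion algebra because basis elements are alternative.  So a
  triad whose indices are dependent generates \<open>H\<close>, and otherwise it spans an algebra on the seven
  points of a Fano plane whose multiplication is an orientation of the seven lines.  Changing signs
  of basis elements normalizes four of the lines, which leaves three signs, hence eight cases; one of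
  them is \<open>O\<close> and the other seven, in which up to signs one line of \<open>O\<close> is reversed, are permuted
  transitively by the collineations.  In particular they are all isomorphic to \<open>P4\<close>.
\<close>

text \<open>View the orientations of the seven lines as vectors over the field with two elements.
  Changing the sign of a basis element adds the incidence vector of a point, and these vectors span
  the Hamming code of length 7 and dimension 4. The code is perfect: every coset has exactly one
  representative of weight at most one. This is why, up to signs, at most one line differs from
  \<open>O\<close>; \<open>triple_signs\<close> is the syndrome that tells which one.

  What survives is the alternative law for two basis elements. It suffices because the signs along
  one line involve only products of two of its points. To compare algebras that live at different
  heights, both are written as twisted group algebras over the same group of bit vectors; equal sign
  functions then give an isomorphism.\<close>

declare One_nat_def [simp del]

subsection \<open>Index sets under symmetric difference\<close>

definition symdiff :: "nat set \<Rightarrow> nat set \<Rightarrow> nat set" (infixl "\<triangle>" 70)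
  where "\<alpha> \<triangle> \<beta> = (\<alpha> - \<beta>) \<union> (\<beta> - \<alpha>)"

interpretation symdiff: comm_monoid symdiff "{}"
  by unfold_locales (auto simp: symdiff_def)

lemma symdiff_self [simp]: "\<alpha> \<triangle> \<alpha> = {}"
  by (auto simp: symdiff_def)

lemma symdiff_cancel [simp]: "\<alpha> \<triangle> (\<alpha> \<triangle> \<beta>) = \<beta>"
  by (auto simp: symdiff_def)

lemma symdiff_eq_empty [simp]: "\<alpha> \<triangle> \<beta> = {} \<longleftrightarrow> \<alpha> = \<beta>" "{} = \<alpha> \<triangle> \<beta> \<longleftrightarrow> \<alpha> = \<beta>"
  by (auto simp: symdiff_def)

lemma symdiff_eq_self [simp]: "\<alpha> \<triangle> \<beta> = \<alpha> \<longleftrightarrow> \<beta> = {}" "\<alpha> \<triangle> \<beta> = \<beta> \<longleftrightarrow> \<alpha> = {}"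
  by (auto simp: symdiff_def)

lemma symdiff_left_inject [simp]: "\<alpha> \<triangle> \<beta> = \<alpha> \<triangle> \<gamma> \<longleftrightarrow> \<beta> = \<gamma>"
  by (metis symdiff_cancel)

lemma symdiff_insert:
  assumes "k \<notin> \<alpha>" "k \<notin> \<beta>"
  shows "insert k \<alpha> \<triangle> \<beta> = insert k (\<alpha> \<triangle> \<beta>)"
    and "\<alpha> \<triangle> insert k \<beta> = insert k (\<alpha> \<triangle> \<beta>)"
    and "insert k \<alpha> \<triangle> insert k \<beta> = \<alpha> \<triangle> \<beta>"
  using assms by (auto simp: symdiff_def)

lemma symdiff_subset: "\<alpha> \<subseteq> K \<Longrightarrow> \<beta> \<subseteq> K \<Longrightarrow> \<alpha> \<triangle> \<beta> \<subseteq> K"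
  by (auto simp: symdiff_def)

text \<open>Translation by \<gamma> is an involution of \<open>Pow K\<close>. It exchanges the two
  factors of a convolution term, as needed where the doubling formula reverses the order of
  multiplication.\<close>

lemma sum_symdiff_reindex:
  assumes "\<gamma> \<subseteq> K"
  shows "(\<Sum>\<alpha>\<in>Pow K. F \<alpha> (\<alpha> \<triangle> \<gamma>)) = (\<Sum>\<alpha>\<in>Pow K. F (\<alpha> \<triangle> \<gamma>) \<alpha>)"
  using assms
  by (intro sum.reindex_bij_witness[of _ "\<lambda>\<alpha>. \<alpha> \<triangle> \<gamma>" "\<lambda>\<alpha>. \<alpha> \<triangle> \<gamma>"])
    (simp_all add: symdiff.assoc symdiff_subset)

lemma subset_Suc_cases:
  assumes "\<alpha> \<subseteq> {1..Suc n}"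
  obtains (without) "\<alpha> \<subseteq> {1..n}"
  | ("with") \<alpha>' where "\<alpha> = insert (Suc n) \<alpha>'" "\<alpha>' \<subseteq> {1..n}"
proof (cases "Suc n \<in> \<alpha>")
  case True
  have "\<alpha> - {Suc n} \<subseteq> {1..n}"
    using assms by (force simp: atLeastAtMostSuc_conv)
  then show ?thesis
    using True that(2)[of "\<alpha> - {Suc n}"] by blast
next
  case False
  then have "\<alpha> \<subseteq> {1..n}"
    using assms by (auto simp: atLeastAtMostSuc_conv)
  then show ?thesis by (rule that)
qed

lemma Suc_notin: "\<alpha> \<subseteq> {1..n} \<Longrightarrow> Suc n \<notin> \<alpha>"
  by auto

lemma sum_Pow_Suc:
  "(\<Sum>\<alpha>\<in>Pow {1..Suc n}. F \<alpha>) =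
   (\<Sum>\<alpha>\<in>Pow {1..n}. F \<alpha>) + (\<Sum>\<alpha>\<in>Pow {1..n}. F (insert (Suc n) \<alpha>))"
proof -
  have "{1..Suc n} = insert (Suc n) {1..n}" by auto
  then have "Pow {1..Suc n} = Pow {1..n} \<union> insert (Suc n) ` Pow {1..n}"
    by (metis Pow_insert)
  moreover have "inj_on (insert (Suc n)) (Pow {1..n})"
    by (intro inj_onI) (metis PowD Suc_notin insert_ident)
  moreover have "Pow {1..n} \<inter> insert (Suc n) ` Pow {1..n} = {}"
    by auto
  ultimately show ?thesis
    by (simp add: sum.union_disjoint sum.reindex)
qed

subsection \<open>Coordinates and signs\<close>

text \<open>Reading a tree as a function on index sets makes the linear operations pointwise. Values
  outside \<open>Pow {1..n}\<close> are ignored, so equality of trees is equality of functions on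
  that set only.\<close>

primrec of_coords :: "nat \<Rightarrow> (nat set \<Rightarrow> real) \<Rightarrow> cd" where
  "of_coords 0 g = Scalar (g {})"
| "of_coords (Suc n) g =
     Double (of_coords n g) (of_coords n (\<lambda>\<alpha>. g (insert (Suc n) \<alpha>)))"

lemma of_coords_eq_iff: "of_coords n g = of_coords n h \<longleftrightarrow> (\<forall>\<alpha>\<subseteq>{1..n}. g \<alpha> = h \<alpha>)"
proof (induction n arbitrary: g h)
  case (Suc n)
  have "(\<forall>\<alpha>\<subseteq>{1..Suc n}. g \<alpha> = h \<alpha>) \<longleftrightarrow>
    (\<forall>\<alpha>\<subseteq>{1..n}. g \<alpha> = h \<alpha>) \<and> (\<forall>\<alpha>\<subseteq>{1..n}. g (insert (Suc n) \<alpha>) = h (insert (Suc n) \<alpha>))"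
    (is "?L \<longleftrightarrow> ?R")
  proof
    assume L: ?L
    have "\<alpha> \<subseteq> {1..Suc n}" "insert (Suc n) \<alpha> \<subseteq> {1..Suc n}" if "\<alpha> \<subseteq> {1..n}" for \<alpha>
      using that by auto
    with L show ?R by simp
  next
    assume R: ?R
    show ?L
    proof (intro allI impI)
      fix \<alpha> assume "\<alpha> \<subseteq> {1..Suc n}"
      then show "g \<alpha> = h \<alpha>"
        by (cases rule: subset_Suc_cases) (use R in simp_all)
    qed
  qed
  then show ?case by (simp add: Suc)
qed auto

lemma of_coords_cong: "(\<And>\<alpha>. \<alpha> \<subseteq> {1..n} \<Longrightarrow> g \<alpha> = h \<alpha>) \<Longrightarrow> of_coords n g = of_coords n h"
  by (simp add: of_coords_eq_iff)

lemma cd_algebra_of_coords: "cd_algebra n = range (of_coords n)"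
proof (induction n)
  case (Suc n)
  have "Double (of_coords n g) (of_coords n h) \<in> range (of_coords (Suc n))" for g h
  proof -
    let ?k = "\<lambda>\<alpha>. if Suc n \<in> \<alpha> then h (\<alpha> - {Suc n}) else g \<alpha>"
    have "of_coords n g = of_coords n ?k"
      by (rule of_coords_cong) auto
    moreover have "of_coords n h = of_coords n (\<lambda>\<alpha>. ?k (insert (Suc n) \<alpha>))"
      by (rule of_coords_cong) (simp add: Suc_notin)
    ultimately have "Double (of_coords n g) (of_coords n h) = of_coords (Suc n) ?k"
      by simp
    then show ?thesis by blast
  qed
  then show ?case using Suc by fastforce
next
  case 0
  have "Scalar r \<in> range (of_coords 0)" for r
    by (rule range_eqI[of _ _ "\<lambda>_. r"]) simp
  moreover have "of_coords 0 g \<in> range Scalar" for g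
    by simp
  ultimately show ?case by (simp only: cd_algebra.simps) blast
qed

lemma cd_zero_of_coords: "cd_zero n = of_coords n (\<lambda>_. 0)"
  by (induction n) auto

lemma cd_add_of_coords:
  "cd_add (of_coords n g) (of_coords n h) = of_coords n (\<lambda>\<alpha>. g \<alpha> + h \<alpha>)"
  by (induction n arbitrary: g h) auto

lemma cd_scale_of_coords: "cd_scale r (of_coords n g) = of_coords n (\<lambda>\<alpha>. r * g \<alpha>)"
  by (induction n arbitrary: g) auto

lemma cd_minus_of_coords:
  "cd_minus (of_coords n g) (of_coords n h) = of_coords n (\<lambda>\<alpha>. g \<alpha> - h \<alpha>)"
  by (simp add: cd_minus_def cd_uminus_def cd_scale_of_coords cd_add_of_coords)

text \<open>This sign has two roles: conjugation multiplies the basis element of \<alpha> by it, and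
  it is the square of that element (\<open>mult_sign_self\<close>).\<close>

definition conj_sign :: "nat set \<Rightarrow> real" where
  "conj_sign \<alpha> = (if \<alpha> = {} then 1 else -1)"

lemma cd_conj_of_coords: "cd_conj (of_coords n g) = of_coords n (\<lambda>\<alpha>. conj_sign \<alpha> * g \<alpha>)"
  by (induction n arbitrary: g)
    (auto simp: conj_sign_def cd_uminus_def cd_scale_of_coords)

lemma cd_basis_of_coords:
  "\<alpha> \<subseteq> {1..n} \<Longrightarrow> cd_basis n \<alpha> = of_coords n (\<lambda>\<beta>. if \<beta> = \<alpha> then 1 else 0)"
proof (induction n arbitrary: \<alpha>)
  case (Suc n)
  from Suc.prems show ?case
  proof (cases rule: subset_Suc_cases)
    case without
    then have "Suc n \<notin> \<alpha>" by (rule Suc_notin)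
    then have "insert (Suc n) \<gamma> \<noteq> \<alpha>" for \<gamma> by blast
    then show ?thesis
      using without Suc.IH[of \<alpha>] \<open>Suc n \<notin> \<alpha>\<close>
      by (simp add: cd_zero_of_coords of_coords_eq_iff)
  next
    case ("with" \<alpha>')
    then have "Suc n \<notin> \<alpha>'" by (simp add: Suc_notin)
    moreover have "\<gamma> \<noteq> \<alpha>" if "\<gamma> \<subseteq> {1..n}" for \<gamma>
      using "with" Suc_notin[OF that] by blast
    moreover have "insert (Suc n) \<gamma> = \<alpha> \<longleftrightarrow> \<gamma> = \<alpha>'" if "\<gamma> \<subseteq> {1..n}" for \<gamma>
      unfolding "with"(1) using \<open>Suc n \<notin> \<alpha>'\<close> Suc_notin[OF that] by (simp add: insert_ident)
    ultimately show ?thesis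
      using "with" Suc.IH[of \<alpha>'] by (simp add: cd_zero_of_coords of_coords_eq_iff)
  qed
qed simp

text \<open>The sign in the product of the basis elements of \<alpha> and \<beta>, which is that of
  \<open>\<alpha> \<triangle> \<beta>\<close> up to this sign. The four branches are the four terms
  of the doubling formula; arguments are swapped where the formula puts the second factor
  first.\<close>

primrec mult_sign :: "nat \<Rightarrow> nat set \<Rightarrow> nat set \<Rightarrow> real" where
  "mult_sign 0 \<alpha> \<beta> = 1"
| "mult_sign (Suc n) \<alpha> \<beta> =
     (let \<alpha>' = \<alpha> - {Suc n}; \<beta>' = \<beta> - {Suc n} in
      if Suc n \<in> \<alpha>
      then conj_sign \<beta>' * (if Suc n \<in> \<beta> then - mult_sign n \<beta>' \<alpha>' else mult_sign n \<alpha>' \<beta>')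
      else (if Suc n \<in> \<beta> then mult_sign n \<beta>' \<alpha>' else mult_sign n \<alpha>' \<beta>'))"

lemma mult_sign_Suc:
  assumes "\<alpha> \<subseteq> {1..n}" "\<beta> \<subseteq> {1..n}"
  shows "mult_sign (Suc n) \<alpha> \<beta> = mult_sign n \<alpha> \<beta>"
    and "mult_sign (Suc n) \<alpha> (insert (Suc n) \<beta>) = mult_sign n \<beta> \<alpha>"
    and "mult_sign (Suc n) (insert (Suc n) \<alpha>) \<beta> = conj_sign \<beta> * mult_sign n \<alpha> \<beta>"
    and "mult_sign (Suc n) (insert (Suc n) \<alpha>) (insert (Suc n) \<beta>) =
           - conj_sign \<beta> * mult_sign n \<beta> \<alpha>"
  using Suc_notin[OF assms(1)] Suc_notin[OF assms(2)] by (simp_all add: Let_def)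

declare mult_sign.simps(2) [simp del]

text \<open>The product of a twisted group algebra over the index sets: once \<alpha> is chosen, the
  other factor contributing to \<gamma> must have index
  \<open>\<alpha> \<triangle> \<gamma>\<close>.\<close>

definition convolution :: "nat \<Rightarrow> (nat set \<Rightarrow> real) \<Rightarrow> (nat set \<Rightarrow> real) \<Rightarrow> nat set \<Rightarrow> real" where
  "convolution n g h \<gamma> =
     (\<Sum>\<alpha>\<in>Pow {1..n}. mult_sign n \<alpha> (\<alpha> \<triangle> \<gamma>) * g \<alpha> * h (\<alpha> \<triangle> \<gamma>))"

text \<open>Coordinates \<gamma> without and with \<open>Suc n\<close> are the two components of the
  doubled product. Each is a sum of two convolutions, matching the split of the sum over \<alpha> by
  membership of \<open>Suc n\<close>; the terms with reversed factors are reindexed before the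
  comparison.\<close>

lemma cd_mult_of_coords:
  "cd_mult (of_coords n g) (of_coords n h) = of_coords n (convolution n g h)"
proof (induction n arbitrary: g h)
  case (Suc n)
  let ?i = "insert (Suc n)"
  let ?g = "\<lambda>\<alpha>. g (?i \<alpha>)" and ?h = "\<lambda>\<alpha>. h (?i \<alpha>)"
  have sub: "\<alpha> \<triangle> \<gamma> \<subseteq> {1..n}" "Suc n \<notin> \<alpha>" "Suc n \<notin> \<gamma>"
    if "\<alpha> \<subseteq> {1..n}" "\<gamma> \<subseteq> {1..n}" for \<alpha> \<gamma>
    using that by (auto simp: symdiff_def)
  have 1: "convolution n g h \<gamma> - convolution n (\<lambda>\<alpha>. conj_sign \<alpha> * ?h \<alpha>) ?g \<gamma> =
      convolution (Suc n) g h \<gamma>" if "\<gamma> \<subseteq> {1..n}" for \<gamma>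
  proof -
    have "convolution n (\<lambda>\<alpha>. conj_sign \<alpha> * ?h \<alpha>) ?g \<gamma> =
      (\<Sum>\<alpha>\<in>Pow {1..n}. mult_sign n (\<alpha> \<triangle> \<gamma>) \<alpha> * (conj_sign (\<alpha> \<triangle> \<gamma>) * ?h (\<alpha> \<triangle> \<gamma>)) * ?g \<alpha>)"
      unfolding convolution_def using that by (rule sum_symdiff_reindex)
    also have "\<dots> = - (\<Sum>\<alpha>\<in>Pow {1..n}.
        mult_sign (Suc n) (?i \<alpha>) (?i \<alpha> \<triangle> \<gamma>) * g (?i \<alpha>) * h (?i \<alpha> \<triangle> \<gamma>))"
      unfolding sum_negf[symmetric] using that sub
      by (intro sum.cong) (auto simp: symdiff_insert mult_sign_Suc)
    moreover have "convolution n g h \<gamma> =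
        (\<Sum>\<alpha>\<in>Pow {1..n}. mult_sign (Suc n) \<alpha> (\<alpha> \<triangle> \<gamma>) * g \<alpha> * h (\<alpha> \<triangle> \<gamma>))"
      unfolding convolution_def using that sub
      by (intro sum.cong) (auto simp: mult_sign_Suc)
    ultimately show ?thesis
      by (simp add: convolution_def sum_Pow_Suc)
  qed
  have 2: "convolution n ?h g \<gamma> + convolution n ?g (\<lambda>\<alpha>. conj_sign \<alpha> * h \<alpha>) \<gamma> =
      convolution (Suc n) g h (?i \<gamma>)" if "\<gamma> \<subseteq> {1..n}" for \<gamma>
  proof -
    have "convolution n ?h g \<gamma> =
        (\<Sum>\<alpha>\<in>Pow {1..n}. mult_sign n (\<alpha> \<triangle> \<gamma>) \<alpha> * ?h (\<alpha> \<triangle> \<gamma>) * g \<alpha>)"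
      unfolding convolution_def using that by (rule sum_symdiff_reindex)
    also have "\<dots> = (\<Sum>\<alpha>\<in>Pow {1..n}.
        mult_sign (Suc n) \<alpha> (\<alpha> \<triangle> ?i \<gamma>) * g \<alpha> * h (\<alpha> \<triangle> ?i \<gamma>))"
      using that sub by (intro sum.cong) (auto simp: symdiff_insert mult_sign_Suc)
    moreover have "convolution n ?g (\<lambda>\<alpha>. conj_sign \<alpha> * h \<alpha>) \<gamma> = (\<Sum>\<alpha>\<in>Pow {1..n}.
        mult_sign (Suc n) (?i \<alpha>) (?i \<alpha> \<triangle> ?i \<gamma>) * g (?i \<alpha>) * h (?i \<alpha> \<triangle> ?i \<gamma>))"
      unfolding convolution_def using that sub
      by (intro sum.cong) (auto simp: symdiff_insert mult_sign_Suc)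
    ultimately show ?thesis
      by (simp add: convolution_def sum_Pow_Suc)
  qed
  show ?case
    using 1 2
    by (simp add: Suc cd_conj_of_coords cd_minus_of_coords cd_add_of_coords of_coords_eq_iff)
qed (simp add: convolution_def)

section \<open>Unit, square, anticommutative and alternative laws for the signs\<close>

lemma mult_sign_pm1: "mult_sign n \<alpha> \<beta> = 1 \<or> mult_sign n \<alpha> \<beta> = -1"
  by (induction n arbitrary: \<alpha> \<beta>) (auto simp: Let_def conj_sign_def mult_sign.simps(2))

lemma mult_sign_square [simp]: "mult_sign n \<alpha> \<beta> * mult_sign n \<alpha> \<beta> = 1"
  using mult_sign_pm1[of n \<alpha> \<beta>] by auto

lemma mult_sign_unit:
  "\<alpha> \<subseteq> {1..n} \<Longrightarrow> mult_sign n {} \<alpha> = 1 \<and> mult_sign n \<alpha> {} = 1"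
proof (induction n arbitrary: \<alpha>)
  case (Suc n)
  from Suc.prems show ?case
    by (cases rule: subset_Suc_cases) (auto simp: mult_sign_Suc Suc.IH conj_sign_def)
qed simp

lemma mult_sign_self: "\<alpha> \<subseteq> {1..n} \<Longrightarrow> mult_sign n \<alpha> \<alpha> = conj_sign \<alpha>"
proof (induction n arbitrary: \<alpha>)
  case (Suc n)
  from Suc.prems show ?case
  proof (cases rule: subset_Suc_cases)
    case without
    then show ?thesis by (simp add: mult_sign_Suc Suc.IH)
  next
    case ("with" \<alpha>')
    then show ?thesis by (auto simp: mult_sign_Suc Suc.IH conj_sign_def)
  qed
qed (simp add: conj_sign_def)

text \<open>If only one index set contains \<open>Suc n\<close>, the two orders differ by the
  conjugation of the other factor, which is pure. If both contain it, the lower level supplies the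
  sign, except when one of the remainders is the unit, which conjugation fixes.\<close>

lemma mult_sign_anticommute:
  assumes "\<alpha> \<subseteq> {1..n}" "\<beta> \<subseteq> {1..n}" "\<alpha> \<noteq> {}" "\<beta> \<noteq> {}" "\<alpha> \<noteq> \<beta>"
  shows "mult_sign n \<beta> \<alpha> = - mult_sign n \<alpha> \<beta>"
  using assms
proof (induction n arbitrary: \<alpha> \<beta>)
  case (Suc n)
  show ?case
    using Suc.prems(1)
  proof (cases rule: subset_Suc_cases)
    case \<alpha>: without
    from Suc.prems(2) show ?thesis
    proof (cases rule: subset_Suc_cases)
      case without
      with \<alpha> Suc.prems Suc.IH[of \<alpha> \<beta>] show ?thesis
        by (simp add: mult_sign_Suc)
    next
      case ("with" \<beta>')
      with \<alpha> Suc.prems show ?thesis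
        by (simp add: mult_sign_Suc conj_sign_def)
    qed
  next
    case \<alpha>: ("with" \<alpha>')
    from Suc.prems(2) show ?thesis
    proof (cases rule: subset_Suc_cases)
      case without
      with \<alpha> Suc.prems show ?thesis
        by (simp add: mult_sign_Suc conj_sign_def)
    next
      case ("with" \<beta>')
      then have "\<alpha>' \<noteq> \<beta>'" using \<alpha> Suc.prems by blast
      with \<alpha> "with" Suc.IH[of \<alpha>' \<beta>'] show ?thesis
        by (cases "\<alpha>' = {}"; cases "\<beta>' = {}")
          (simp_all add: mult_sign_Suc conj_sign_def mult_sign_unit)
    qed
  qed
qed simp

text \<open>The left and the right alternative laws exchange their roles in the induction.\<close>

lemma mult_sign_alternative:
  assumes "\<alpha> \<subseteq> {1..n}" "\<beta> \<subseteq> {1..n}"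
  shows "mult_sign n \<alpha> \<beta> * mult_sign n \<alpha> (\<alpha> \<triangle> \<beta>) = conj_sign \<alpha> \<and>
    mult_sign n \<beta> \<alpha> * mult_sign n (\<alpha> \<triangle> \<beta>) \<alpha> = conj_sign \<alpha>"
  using assms
proof (induction n arbitrary: \<alpha> \<beta>)
  case (Suc n)
  \<comment> \<open>If \<open>Suc n\<close> lies in \<alpha>, the left law one level up multiplies
    by the remainder of \<alpha> once on each side, with two conjugations. Apart from the degenerate
    cases, anticommutativity turns this into a one-sided law of the lower level.\<close>
  have mixed: "conj_sign \<beta> * mult_sign n \<beta> \<alpha> * (conj_sign (\<alpha> \<triangle> \<beta>) * mult_sign n \<alpha> (\<alpha> \<triangle> \<beta>)) = 1"
    "conj_sign \<beta> * mult_sign n \<alpha> \<beta> * (conj_sign (\<alpha> \<triangle> \<beta>) * mult_sign n (\<alpha> \<triangle> \<beta>) \<alpha>) = 1"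
    if sub: "\<alpha> \<subseteq> {1..n}" "\<beta> \<subseteq> {1..n}" for \<alpha> \<beta>
  proof -
    consider "\<alpha> = {}" | "\<beta> = {}" | "\<alpha> = \<beta>" | "\<alpha> \<noteq> {}" "\<beta> \<noteq> {}" "\<alpha> \<noteq> \<beta>"
      by blast
    then have "conj_sign \<beta> * mult_sign n \<beta> \<alpha> * (conj_sign (\<alpha> \<triangle> \<beta>) * mult_sign n \<alpha> (\<alpha> \<triangle> \<beta>)) = 1 \<and>
      conj_sign \<beta> * mult_sign n \<alpha> \<beta> * (conj_sign (\<alpha> \<triangle> \<beta>) * mult_sign n (\<alpha> \<triangle> \<beta>) \<alpha>) = 1"
    proof cases
      case 4
      then have "mult_sign n \<beta> \<alpha> = - mult_sign n \<alpha> \<beta>"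
        using sub by (intro mult_sign_anticommute)
      then show ?thesis
        using Suc.IH[OF sub] 4 by (simp add: conj_sign_def)
    qed (use sub in \<open>simp_all add: mult_sign_unit mult_sign_self conj_sign_def\<close>)
    then show "conj_sign \<beta> * mult_sign n \<beta> \<alpha> * (conj_sign (\<alpha> \<triangle> \<beta>) * mult_sign n \<alpha> (\<alpha> \<triangle> \<beta>)) = 1"
      "conj_sign \<beta> * mult_sign n \<alpha> \<beta> * (conj_sign (\<alpha> \<triangle> \<beta>) * mult_sign n (\<alpha> \<triangle> \<beta>) \<alpha>) = 1"
      by blast+
  qed
  have conj_sign_square: "conj_sign \<gamma> * conj_sign \<gamma> = 1" for \<gamma>
    by (simp add: conj_sign_def)
  show ?case
    using Suc.prems(1)
  proof (cases rule: subset_Suc_cases)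
    case \<alpha>: without
    from Suc.prems(2) show ?thesis
    proof (cases rule: subset_Suc_cases)
      case without
      then show ?thesis
        using \<alpha> Suc.IH[of \<alpha> \<beta>] by (simp add: mult_sign_Suc symdiff_subset)
    next
      case ("with" \<beta>')
      then have "\<alpha> \<triangle> \<beta> = insert (Suc n) (\<alpha> \<triangle> \<beta>')"
        using \<alpha> by (simp add: symdiff_insert Suc_notin)
      then show ?thesis
        using \<alpha> "with" Suc.IH[of \<alpha> \<beta>'] conj_sign_square[of \<alpha>]
        by (simp add: mult_sign_Suc symdiff_subset mult_ac)
    qed
  next
    case \<alpha>: ("with" \<alpha>')
    have conj: "conj_sign \<alpha> = -1"
      using \<alpha> by (simp add: conj_sign_def)
    from Suc.prems(2) show ?thesis
    proof (cases rule: subset_Suc_cases)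
      case without
      then have "\<alpha> \<triangle> \<beta> = insert (Suc n) (\<alpha>' \<triangle> \<beta>)"
        using \<alpha> by (simp add: symdiff_insert Suc_notin)
      then show ?thesis
        using \<alpha> without Suc.IH[of \<alpha>' \<beta>] mixed[of \<alpha>' \<beta>] conj_sign_square[of \<alpha>'] conj
        by (simp add: mult_sign_Suc symdiff_subset mult_ac)
    next
      case ("with" \<beta>')
      then have "\<alpha> \<triangle> \<beta> = \<alpha>' \<triangle> \<beta>'"
        using \<alpha> by (simp add: symdiff_insert Suc_notin)
      then show ?thesis
        using \<alpha> "with" Suc.IH[of \<alpha>' \<beta>'] mixed[of \<alpha>' \<beta>'] conj_sign_square[of \<alpha>'] conj
        by (simp add: mult_sign_Suc symdiff_subset mult_ac)
    qed
  qed
qed (simp add: conj_sign_def)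

subsection \<open>Generated subalgebras\<close>

text \<open>Encoding the span by supports of coordinate functions reduces closure under the
  operations to a statement about index sets.\<close>

definition basis_span :: "nat \<Rightarrow> nat set set \<Rightarrow> cd set" where
  "basis_span n H = of_coords n ` {g. \<forall>\<alpha>. \<alpha> \<notin> H \<longrightarrow> g \<alpha> = 0}"

lemma basis_spanI: "(\<And>\<alpha>. \<alpha> \<notin> H \<Longrightarrow> g \<alpha> = 0) \<Longrightarrow> of_coords n g \<in> basis_span n H"
  unfolding basis_span_def by (rule imageI) simp

lemma basis_spanE:
  assumes "x \<in> basis_span n H"
  obtains g where "x = of_coords n g" "\<And>\<alpha>. \<alpha> \<notin> H \<Longrightarrow> g \<alpha> = 0"
  using assms that unfolding basis_span_def by (elim imageE CollectE) simp

lemma cd_algebra_eq_basis_span: "cd_algebra n = basis_span n (Pow {1..n})"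
proof -
  have "of_coords n g \<in> basis_span n (Pow {1..n})" for g
  proof -
    have "of_coords n g = of_coords n (\<lambda>\<alpha>. if \<alpha> \<subseteq> {1..n} then g \<alpha> else 0)"
      by (rule of_coords_cong) simp
    also have "\<dots> \<in> basis_span n (Pow {1..n})"
      by (rule basis_spanI) simp
    finally show ?thesis .
  qed
  moreover have "basis_span n (Pow {1..n}) \<subseteq> range (of_coords n)"
    by (auto elim: basis_spanE)
  ultimately show ?thesis
    unfolding cd_algebra_of_coords by (intro antisym image_subsetI)
qed

text \<open>The subgroup generated by \<open>K\<close>; every index set is its own inverse, so no
  rule for inverses appears.\<close>

inductive_set symdiff_closure :: "nat set set \<Rightarrow> nat set set" for K where
  empty: "{} \<in> symdiff_closure K"
| generator: "\<alpha> \<in> K \<Longrightarrow> \<alpha> \<in> symdiff_closure K"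
| symdiff: "\<alpha> \<in> symdiff_closure K \<Longrightarrow> \<beta> \<in> symdiff_closure K \<Longrightarrow> \<alpha> \<triangle> \<beta> \<in> symdiff_closure K"

lemma symdiff_closure_subset:
  assumes "K \<subseteq> H" "{} \<in> H" "\<And>\<alpha> \<beta>. \<alpha> \<in> H \<Longrightarrow> \<beta> \<in> H \<Longrightarrow> \<alpha> \<triangle> \<beta> \<in> H"
  shows "symdiff_closure K \<subseteq> H"
proof
  fix \<alpha> assume "\<alpha> \<in> symdiff_closure K"
  then show "\<alpha> \<in> H" by induction (use assms in auto)
qed

lemma cd_mult_basis:
  assumes "\<alpha> \<subseteq> {1..n}" "\<beta> \<subseteq> {1..n}"
  shows "cd_mult (cd_basis n \<alpha>) (cd_basis n \<beta>) =
         cd_scale (mult_sign n \<alpha> \<beta>) (cd_basis n (\<alpha> \<triangle> \<beta>))"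
proof -
  have "convolution n (\<lambda>\<delta>. if \<delta> = \<alpha> then 1 else 0) (\<lambda>\<delta>. if \<delta> = \<beta> then 1 else 0) \<gamma> =
        mult_sign n \<alpha> \<beta> * (if \<gamma> = \<alpha> \<triangle> \<beta> then 1 else 0)" for \<gamma>
  proof -
    have "convolution n (\<lambda>\<delta>. if \<delta> = \<alpha> then 1 else 0) (\<lambda>\<delta>. if \<delta> = \<beta> then 1 else 0) \<gamma> =
       (\<Sum>\<delta>\<in>Pow {1..n}. if \<delta> = \<alpha> then mult_sign n \<alpha> (\<alpha> \<triangle> \<gamma>) * (if \<alpha> \<triangle> \<gamma> = \<beta> then 1 else 0) else 0)"
      unfolding convolution_def by (intro sum.cong) auto
    also have "\<dots> = mult_sign n \<alpha> (\<alpha> \<triangle> \<gamma>) * (if \<alpha> \<triangle> \<gamma> = \<beta> then 1 else 0)"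
      using assms by (simp add: sum.delta)
    finally show ?thesis by auto
  qed
  then show ?thesis
    using assms by (simp add: cd_basis_of_coords symdiff_subset cd_mult_of_coords cd_scale_of_coords
        of_coords_eq_iff)
qed

lemma cd_subalgebra_basis_span:
  assumes "{} \<in> H" "\<And>\<alpha> \<beta>. \<alpha> \<in> H \<Longrightarrow> \<beta> \<in> H \<Longrightarrow> \<alpha> \<triangle> \<beta> \<in> H"
  shows "cd_subalgebra n (basis_span n H)"
proof -
  have "convolution n g h \<gamma> = 0"
    if g: "\<forall>\<alpha>. \<alpha> \<notin> H \<longrightarrow> g \<alpha> = 0" and h: "\<forall>\<alpha>. \<alpha> \<notin> H \<longrightarrow> h \<alpha> = 0" and "\<gamma> \<notin> H" for g h \<gamma>
    unfolding convolution_def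
  proof (intro sum.neutral ballI)
    fix \<alpha>
    have "\<alpha> \<notin> H \<or> \<alpha> \<triangle> \<gamma> \<notin> H"
      using assms(2)[of \<alpha> "\<alpha> \<triangle> \<gamma>"] \<open>\<gamma> \<notin> H\<close> by auto
    then show "mult_sign n \<alpha> (\<alpha> \<triangle> \<gamma>) * g \<alpha> * h (\<alpha> \<triangle> \<gamma>) = 0"
      using g h by auto
  qed
  then have "cd_mult x y \<in> basis_span n H" if "x \<in> basis_span n H" "y \<in> basis_span n H" for x y
    using that by (elim basis_spanE) (simp add: cd_mult_of_coords basis_spanI)
  moreover have "cd_add x y \<in> basis_span n H" if "x \<in> basis_span n H" "y \<in> basis_span n H" for x y
    using that by (elim basis_spanE) (simp add: cd_add_of_coords basis_spanI)
  moreover have "cd_scale r x \<in> basis_span n H" if "x \<in> basis_span n H" for r x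
    using that by (elim basis_spanE) (simp add: cd_scale_of_coords basis_spanI)
  moreover have "cd_zero n \<in> basis_span n H"
    by (simp add: cd_zero_of_coords basis_spanI)
  moreover have "basis_span n H \<subseteq> cd_algebra n"
    unfolding cd_algebra_of_coords by (auto elim: basis_spanE)
  ultimately show ?thesis
    by (simp add: cd_subalgebra_def)
qed

lemma cd_basis_in_basis_span:
  "\<alpha> \<in> H \<Longrightarrow> \<alpha> \<subseteq> {1..n} \<Longrightarrow> cd_basis n \<alpha> \<in> basis_span n H"
  by (simp add: cd_basis_of_coords) (rule basis_spanI, auto)

text \<open>Linear combinations are built by splitting off one basis element at a time, using only
  addition and scaling inside \<open>S\<close>.\<close>

lemma basis_span_subset:
  assumes S: "cd_subalgebra n S" and "H \<subseteq> Pow {1..n}" and basis: "\<And>\<alpha>. \<alpha> \<in> H \<Longrightarrow> cd_basis n \<alpha> \<in> S"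
  shows "basis_span n H \<subseteq> S"
proof -
  have "finite H" by (rule finite_subset[OF assms(2)]) simp
  then have "\<forall>g. (\<forall>\<alpha>. \<alpha> \<notin> H \<longrightarrow> g \<alpha> = 0) \<longrightarrow> of_coords n g \<in> S"
    using assms(2) basis
  proof (induction H rule: finite_induct)
    case empty
    have "g = (\<lambda>_. 0)" if "\<forall>\<alpha>. \<alpha> \<notin> {} \<longrightarrow> g \<alpha> = (0::real)" for g :: "nat set \<Rightarrow> real"
      using that by auto
    moreover have "of_coords n (\<lambda>_. 0) \<in> S"
      using S by (simp add: cd_subalgebra_def flip: cd_zero_of_coords)
    ultimately show ?case by blast
  next
    case (insert \<beta> H)
    show ?case
    proof (intro allI impI)
      fix g :: "nat set \<Rightarrow> real"
      assume g: "\<forall>\<alpha>. \<alpha> \<notin> insert \<beta> H \<longrightarrow> g \<alpha> = 0"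
      let ?h = "\<lambda>\<alpha>. if \<alpha> = \<beta> then 0 else g \<alpha>"
      have "of_coords n ?h \<in> S"
        using insert g by auto
      moreover have "cd_scale (g \<beta>) (cd_basis n \<beta>) \<in> S"
        using insert S by (auto simp: cd_subalgebra_def)
      moreover have "of_coords n g = cd_add (of_coords n ?h) (cd_scale (g \<beta>) (cd_basis n \<beta>))"
        using insert.prems
        by (simp add: cd_basis_of_coords cd_scale_of_coords cd_add_of_coords of_coords_eq_iff)
      ultimately show "of_coords n g \<in> S"
        using S by (simp add: cd_subalgebra_def)
    qed
  qed
  then show ?thesis by (auto elim!: basis_spanE)
qed

lemma cd_generated_basis:
  assumes K: "K \<subseteq> Pow {1..n}" and pure: "\<kappa> \<in> K" "\<kappa> \<noteq> {}"
  shows "cd_generated n (cd_basis n ` K) = basis_span n (symdiff_closure K)"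
proof (rule antisym)
  have bound: "symdiff_closure K \<subseteq> Pow {1..n}"
    by (rule symdiff_closure_subset) (use K symdiff_subset in auto)
  have "cd_subalgebra n (basis_span n (symdiff_closure K))"
    by (rule cd_subalgebra_basis_span) (auto intro: symdiff_closure.intros)
  moreover have "cd_basis n ` K \<subseteq> basis_span n (symdiff_closure K)"
    using K by (auto intro!: cd_basis_in_basis_span symdiff_closure.intros)
  ultimately show "cd_generated n (cd_basis n ` K) \<subseteq> basis_span n (symdiff_closure K)"
    by (auto simp: cd_generated_def)
  have "basis_span n (symdiff_closure K) \<subseteq> S"
    if S: "cd_subalgebra n S" and KS: "cd_basis n ` K \<subseteq> S" for S
  proof (rule basis_span_subset[OF S bound])
    have prod: "cd_basis n (\<alpha> \<triangle> \<beta>) \<in> S"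
      if "cd_basis n \<alpha> \<in> S" "cd_basis n \<beta> \<in> S" "\<alpha> \<subseteq> {1..n}" "\<beta> \<subseteq> {1..n}" for \<alpha> \<beta>
    proof -
      have "cd_scale (mult_sign n \<alpha> \<beta>) (cd_mult (cd_basis n \<alpha>) (cd_basis n \<beta>)) \<in> S"
        using S that by (auto simp: cd_subalgebra_def)
      also have "cd_scale (mult_sign n \<alpha> \<beta>) (cd_mult (cd_basis n \<alpha>) (cd_basis n \<beta>)) =
          cd_basis n (\<alpha> \<triangle> \<beta>)"
        unfolding cd_mult_basis[OF that(3,4)] cd_basis_of_coords[OF symdiff_subset[OF that(3,4)]]
        by (simp add: cd_scale_of_coords of_coords_eq_iff)
      finally show ?thesis .
    qed
    have "symdiff_closure K \<subseteq> {\<alpha>. \<alpha> \<subseteq> {1..n} \<and> cd_basis n \<alpha> \<in> S}"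
    proof (rule symdiff_closure_subset)
      show "{} \<in> {\<alpha>. \<alpha> \<subseteq> {1..n} \<and> cd_basis n \<alpha> \<in> S}"
        \<comment> \<open>A subalgebra is not assumed to contain the unit; it is obtained from the
          square of the basis element of \<kappa>.\<close>
        using prod[of \<kappa> \<kappa>] pure K KS by auto
    qed (use K KS prod symdiff_subset in auto)
    then show "cd_basis n \<alpha> \<in> S" if "\<alpha> \<in> symdiff_closure K" for \<alpha>
      using that by auto
  qed
  then show "basis_span n (symdiff_closure K) \<subseteq> cd_generated n (cd_basis n ` K)"
    by (auto simp: cd_generated_def)
qed

subsection \<open>Isomorphism from equal twists\<close>

text \<open>The basis elements \<open>cd_basis n (\<phi> v)\<close>, rescaled by the signs
  \<open>\<epsilon> v\<close> and labelled by an abstract group. Different embeddings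
  \<open>\<phi>\<close> of the same group can then be compared.\<close>

locale indexed_basis =
  fixes n :: nat and add :: "'i::finite \<Rightarrow> 'i \<Rightarrow> 'i"
    and \<phi> :: "'i \<Rightarrow> nat set" and \<epsilon> :: "'i \<Rightarrow> real"
  assumes inj: "inj \<phi>"
    and bounded: "\<phi> v \<subseteq> {1..n}"
    and add: "\<phi> (add v w) = \<phi> v \<triangle> \<phi> w"
    and sign: "\<epsilon> v * \<epsilon> v = 1"
begin

text \<open>The structure constants of the rescaled basis: the product of elements \<open>v\<close>
  and \<open>w\<close> is \<open>twist v w\<close> times element \<open>add v w\<close>. The last
  factor \<open>\<epsilon>\<close> is its own inverse.\<close>

definition twist :: "'i \<Rightarrow> 'i \<Rightarrow> real" where
  "twist v w = mult_sign n (\<phi> v) (\<phi> w) * \<epsilon> v * \<epsilon> w * \<epsilon> (add v w)"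

definition lift :: "('i \<Rightarrow> real) \<Rightarrow> cd" where
  "lift r = of_coords n (\<lambda>\<alpha>. if \<alpha> \<in> range \<phi> then \<epsilon> (inv \<phi> \<alpha>) * r (inv \<phi> \<alpha>) else 0)"

lemma sign_cancel: "\<epsilon> v * (\<epsilon> v * x) = x"
  by (simp add: sign flip: mult.assoc)

lemma add_cancel: "add v (add v w) = w"
  by (rule injD[OF inj]) (simp add: add)

lemma add_commute: "add v w = add w v"
  by (rule injD[OF inj]) (simp add: add symdiff.commute)

lemma lift_eq_iff: "lift r = lift s \<longleftrightarrow> r = s"
proof
  assume eq: "lift r = lift s"
  show "r = s"
  proof
    fix v
    have "\<epsilon> v * r v = \<epsilon> v * s v"
      using eq bounded[of v] inj by (force simp: lift_def of_coords_eq_iff)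
    then have "\<epsilon> v * (\<epsilon> v * r v) = \<epsilon> v * (\<epsilon> v * s v)" by simp
    then show "r v = s v" by (simp only: sign_cancel)
  qed
qed simp

lemma range_lift: "range lift = basis_span n (range \<phi>)"
proof
  show "basis_span n (range \<phi>) \<subseteq> range lift"
  proof
    fix x assume "x \<in> basis_span n (range \<phi>)"
    then obtain g where g: "x = of_coords n g" "\<forall>\<alpha>. \<alpha> \<notin> range \<phi> \<longrightarrow> g \<alpha> = 0"
      by (elim basis_spanE) blast
    have "x = lift (\<lambda>v. \<epsilon> v * g (\<phi> v))"
      unfolding g lift_def by (rule of_coords_cong) (use g inj sign_cancel in auto)
    then show "x \<in> range lift" by blast
  qed
  show "range lift \<subseteq> basis_span n (range \<phi>)"
    by (auto simp: lift_def intro: basis_spanI)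
qed

lemma cd_add_lift: "cd_add (lift r) (lift s) = lift (\<lambda>v. r v + s v)"
  by (simp add: lift_def cd_add_of_coords of_coords_eq_iff distrib_left)

lemma cd_scale_lift: "cd_scale c (lift r) = lift (\<lambda>v. c * r v)"
  by (simp add: lift_def cd_scale_of_coords of_coords_eq_iff)

text \<open>The range of \<open>\<phi>\<close> is closed under symmetric difference. Hence a
  coordinate outside it receives no contribution, and one inside it is a sum over the index group
  alone.\<close>

lemma cd_mult_lift:
  "cd_mult (lift r) (lift s) = lift (\<lambda>k. \<Sum>i\<in>UNIV. twist i (add i k) * r i * s (add i k))"
proof -
  let ?g = "\<lambda>r \<alpha>. if \<alpha> \<in> range \<phi> then \<epsilon> (inv \<phi> \<alpha>) * r (inv \<phi> \<alpha>) else 0"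
  have g: "?g r (\<phi> v) = \<epsilon> v * r v" for r :: "'i \<Rightarrow> real" and v
    using inj by simp
  have conv: "convolution n (?g r) (?g s) \<gamma> =
      (\<Sum>i\<in>UNIV. mult_sign n (\<phi> i) (\<phi> i \<triangle> \<gamma>) * ?g r (\<phi> i) * ?g s (\<phi> i \<triangle> \<gamma>))" for \<gamma>
  proof -
    have "convolution n (?g r) (?g s) \<gamma> =
      (\<Sum>\<alpha>\<in>range \<phi>. mult_sign n \<alpha> (\<alpha> \<triangle> \<gamma>) * ?g r \<alpha> * ?g s (\<alpha> \<triangle> \<gamma>))"
      unfolding convolution_def using bounded
      by (intro sum.mono_neutral_right) auto
    then show ?thesis
      using inj by (simp only: sum.reindex o_def)
  qed
  have "convolution n (?g r) (?g s) \<gamma> =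
      ?g (\<lambda>k. \<Sum>i\<in>UNIV. twist i (add i k) * r i * s (add i k)) \<gamma>" for \<gamma>
  proof (cases "\<gamma> \<in> range \<phi>")
    case True
    then obtain k where k: "\<gamma> = \<phi> k" by blast
    have "mult_sign n (\<phi> i) (\<phi> i \<triangle> \<phi> k) * ?g r (\<phi> i) * ?g s (\<phi> i \<triangle> \<phi> k) =
       \<epsilon> k * (twist i (add i k) * r i * s (add i k))" for i
      unfolding add[symmetric] g twist_def add_cancel
      by (simp add: sign_cancel mult.left_commute mult.commute)
    then have "convolution n (?g r) (?g s) (\<phi> k) =
        \<epsilon> k * (\<Sum>i\<in>UNIV. twist i (add i k) * r i * s (add i k))"
      unfolding conv sum_distrib_left by (rule sum.cong[OF refl])
    then show ?thesis
      using inj by (simp add: k)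
  next
    case False
    have "\<phi> i \<triangle> \<gamma> \<notin> range \<phi>" for i
    proof
      assume "\<phi> i \<triangle> \<gamma> \<in> range \<phi>"
      then obtain j where "\<phi> i \<triangle> \<gamma> = \<phi> j" by blast
      then have "\<gamma> = \<phi> (add i j)" by (metis add symdiff_cancel)
      then show False using False by blast
    qed
    then show ?thesis unfolding conv using False by simp
  qed
  then show ?thesis
    by (simp add: lift_def cd_mult_of_coords of_coords_eq_iff)
qed

text \<open>The alternative law v(vw) = (vv)w in terms of structure constants. Together with
  \<open>twist_swap\<close> and \<open>twist_zero\<close> it reduces the whole twist to one value
  per line.\<close>

lemma twist_rotate: "twist v (add v w) = conj_sign (\<phi> v) * twist v w"
proof -
  have "mult_sign n (\<phi> v) (\<phi> v \<triangle> \<phi> w) = conj_sign (\<phi> v) * mult_sign n (\<phi> v) (\<phi> w)"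
    using mult_sign_alternative[OF bounded[of v] bounded[of w]]
      mult_sign_pm1[of n "\<phi> v" "\<phi> w"] by auto
  then show ?thesis
    by (simp add: twist_def add add_cancel mult_ac)
qed

lemma twist_swap:
  "twist w v = (if \<phi> v = {} \<or> \<phi> w = {} \<or> v = w then twist v w else - twist v w)"
proof -
  have "mult_sign n (\<phi> w) (\<phi> v) =
    (if \<phi> v = {} \<or> \<phi> w = {} \<or> v = w then mult_sign n (\<phi> v) (\<phi> w) else - mult_sign n (\<phi> v) (\<phi> w))"
    using mult_sign_anticommute[OF bounded[of v] bounded[of w]] inj_eq[OF inj, of v w]
      mult_sign_unit[OF bounded[of v]] mult_sign_unit[OF bounded[of w]]
    by (simp split: if_splits)
  then show ?thesis
    by (simp add: twist_def add_commute[of w v])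
qed

lemma twist_zero: "\<phi> w = {} \<Longrightarrow> twist v w = \<epsilon> w"
proof -
  assume w: "\<phi> w = {}"
  then have "add v w = v" by (intro injD[OF inj]) (simp add: add)
  then show ?thesis
    using w mult_sign_unit[OF bounded[of v]] by (simp add: twist_def sign_cancel mult_ac)
qed

text \<open>The index of the unit is recognized from \<open>add\<close> alone, so two bases over the
  same group have it in common.\<close>

lemma zero_iff: "\<phi> v = {} \<longleftrightarrow> add v v = v"
  using inj_eq[OF inj, of "add v v" v] by (simp add: add eq_commute)

end

text \<open>The map sends each rescaled basis element to the one with the same label; equal
  structure constants make it multiplicative.\<close>

lemma indexed_basis_isomorphic:
  fixes \<phi> \<phi>' :: "'i::finite \<Rightarrow> nat set"
  assumes "indexed_basis n add \<phi> \<epsilon>" "indexed_basis n' add \<phi>' \<epsilon>'"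
    and twist: "\<And>v w. indexed_basis.twist n add \<phi> \<epsilon> v w = indexed_basis.twist n' add \<phi>' \<epsilon>' v w"
  shows "isomorphic (basis_span n (range \<phi>)) (basis_span n' (range \<phi>'))"
proof -
  interpret B: indexed_basis n add \<phi> \<epsilon> by fact
  interpret B': indexed_basis n' add \<phi>' \<epsilon>' by fact
  let ?f = "\<lambda>x. B'.lift (inv B.lift x)"
  have inj: "inj B.lift" "inj B'.lift"
    by (auto intro!: injI simp: B.lift_eq_iff B'.lift_eq_iff)
  have inv: "inv B.lift (B.lift r) = r" for r
    using inj by simp
  have "bij_betw ?f (range B.lift) (range B'.lift)"
    unfolding bij_betw_def
    by (auto simp: inj_on_def inv B.lift_eq_iff B'.lift_eq_iff image_image simp del: inv_f_f)
  moreover have "(\<lambda>i j. B.twist i j) = (\<lambda>i j. B'.twist i j)"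
    using twist by blast
  ultimately show ?thesis
    unfolding isomorphic_def linear_bijection_def B.range_lift[symmetric] B'.range_lift[symmetric]
    by (intro exI[of _ ?f])
      (auto simp: B.cd_add_lift B.cd_scale_lift B.cd_mult_lift inv
        B'.cd_add_lift B'.cd_scale_lift B'.cd_mult_lift twist simp del: inv_f_f)
qed

section \<open>Bit vectors of length two and three as index groups\<close>

text \<open>Tuples of booleans form a finite type, as \<open>indexed_basis\<close> requires, and
  their pairs can be enumerated by simplification.\<close>

fun xor2 :: "bool \<times> bool \<Rightarrow> bool \<times> bool \<Rightarrow> bool \<times> bool" where
  "xor2 (a, b) (a', b') = (a \<noteq> a', b \<noteq> b')"

fun combination2 :: "nat set \<Rightarrow> nat set \<Rightarrow> bool \<times> bool \<Rightarrow> nat set" where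
  "combination2 \<alpha> \<beta> (a, b) = (if a then \<alpha> else {}) \<triangle> (if b then \<beta> else {})"

fun xor3 :: "bool \<times> bool \<times> bool \<Rightarrow> bool \<times> bool \<times> bool \<Rightarrow> bool \<times> bool \<times> bool" where
  "xor3 (a, b, c) (a', b', c') = (a \<noteq> a', b \<noteq> b', c \<noteq> c')"

fun combination3 :: "nat set \<Rightarrow> nat set \<Rightarrow> nat set \<Rightarrow> bool \<times> bool \<times> bool \<Rightarrow> nat set" where
  "combination3 \<alpha> \<beta> \<gamma> (a, b, c) =
     (if a then \<alpha> else {}) \<triangle> ((if b then \<beta> else {}) \<triangle> (if c then \<gamma> else {}))"

lemma indexed_basisI:
  assumes add: "\<And>v w. \<phi> (add v w) = \<phi> v \<triangle> \<phi> w" "\<And>v w. add v w = zero \<Longrightarrow> v = w"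
    and kernel: "\<And>v. \<phi> v = {} \<Longrightarrow> v = zero"
    and "\<And>v. \<phi> v \<subseteq> {1..n}" "\<And>v. \<epsilon> v * \<epsilon> v = 1"
  shows "indexed_basis n add \<phi> \<epsilon>"
proof
  show "inj \<phi>"
  proof (rule injI)
    fix v w assume "\<phi> v = \<phi> w"
    then have "\<phi> (add v w) = {}" by (simp add: add)
    then show "v = w" by (rule add(2)[OF kernel])
  qed
qed (rule assms)+

lemma combination2_xor:
  "combination2 \<alpha> \<beta> (xor2 v w) = combination2 \<alpha> \<beta> v \<triangle> combination2 \<alpha> \<beta> w"
  by (cases v; cases w)
    (simp add: symdiff.assoc symdiff.left_commute[of \<beta> \<alpha>] symdiff.commute[of \<beta> \<alpha>])

lemma combination3_xor:
  "combination3 \<alpha> \<beta> \<gamma> (xor3 v w) = combination3 \<alpha> \<beta> \<gamma> v \<triangle> combination3 \<alpha> \<beta> \<gamma> w"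
proof -
  have split: "(if p \<noteq> q then x else {}) = (if p then x else {}) \<triangle> (if q then x else {})" for p q x
    by simp
  show ?thesis
    by (cases v; cases w)
      (simp only: xor3.simps combination3.simps split symdiff.assoc symdiff.left_commute symdiff.commute)
qed

text \<open>The bounds on \<open>K\<close> admit both the two generators of \<open>H\<close> and a
  whole line, as in a dependent triad.\<close>

lemma symdiff_closure_pair:
  assumes "\<alpha> \<in> K" "\<beta> \<in> K" "K \<subseteq> {\<alpha>, \<beta>, \<alpha> \<triangle> \<beta>}"
  shows "symdiff_closure K = range (combination2 \<alpha> \<beta>)"
proof
  have "(if a then \<alpha> else {}) \<in> symdiff_closure K" "(if a then \<beta> else {}) \<in> symdiff_closure K" for a
    using assms by (simp_all add: symdiff_closure.empty symdiff_closure.generator)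
  then have "combination2 \<alpha> \<beta> v \<in> symdiff_closure K" for v
    by (cases v) (simp only: combination2.simps symdiff_closure.symdiff)
  then show "range (combination2 \<alpha> \<beta>) \<subseteq> symdiff_closure K" by blast
  show "symdiff_closure K \<subseteq> range (combination2 \<alpha> \<beta>)"
  proof (rule symdiff_closure_subset)
    show "K \<subseteq> range (combination2 \<alpha> \<beta>)"
    proof (rule order.trans[OF assms(3)])
      show "{\<alpha>, \<beta>, \<alpha> \<triangle> \<beta>} \<subseteq> range (combination2 \<alpha> \<beta>)"
        using rangeI[of "combination2 \<alpha> \<beta>" "(True, False)"] rangeI[of "combination2 \<alpha> \<beta>" "(False, True)"]
          rangeI[of "combination2 \<alpha> \<beta>" "(True, True)"] by simp
    qed
    show "{} \<in> range (combination2 \<alpha> \<beta>)"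
      using rangeI[of "combination2 \<alpha> \<beta>" "(False, False)"] by simp
    show "\<delta> \<triangle> \<kappa> \<in> range (combination2 \<alpha> \<beta>)"
      if "\<delta> \<in> range (combination2 \<alpha> \<beta>)" "\<kappa> \<in> range (combination2 \<alpha> \<beta>)" for \<delta> \<kappa>
      using that by (elim imageE) (simp only: flip: combination2_xor, simp)
  qed
qed

lemma symdiff_closure_triple: "symdiff_closure {\<alpha>, \<beta>, \<gamma>} = range (combination3 \<alpha> \<beta> \<gamma>)"
proof
  let ?C = "symdiff_closure {\<alpha>, \<beta>, \<gamma>}"
  have "(if a then \<alpha> else {}) \<in> ?C" "(if a then \<beta> else {}) \<in> ?C" "(if a then \<gamma> else {}) \<in> ?C" for a
    by (simp_all add: symdiff_closure.empty symdiff_closure.generator)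
  then have "combination3 \<alpha> \<beta> \<gamma> v \<in> ?C" for v
    by (cases v) (simp only: combination3.simps symdiff_closure.symdiff)
  then show "range (combination3 \<alpha> \<beta> \<gamma>) \<subseteq> ?C" by blast
  show "?C \<subseteq> range (combination3 \<alpha> \<beta> \<gamma>)"
  proof (rule symdiff_closure_subset)
    show "{\<alpha>, \<beta>, \<gamma>} \<subseteq> range (combination3 \<alpha> \<beta> \<gamma>)"
      using rangeI[of "combination3 \<alpha> \<beta> \<gamma>" "(True, False, False)"]
        rangeI[of "combination3 \<alpha> \<beta> \<gamma>" "(False, True, False)"]
        rangeI[of "combination3 \<alpha> \<beta> \<gamma>" "(False, False, True)"] by simp
    show "{} \<in> range (combination3 \<alpha> \<beta> \<gamma>)"
      using rangeI[of "combination3 \<alpha> \<beta> \<gamma>" "(False, False, False)"] by simp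
    show "\<delta> \<triangle> \<kappa> \<in> range (combination3 \<alpha> \<beta> \<gamma>)"
      if "\<delta> \<in> range (combination3 \<alpha> \<beta> \<gamma>)" "\<kappa> \<in> range (combination3 \<alpha> \<beta> \<gamma>)" for \<delta> \<kappa>
      using that by (elim imageE) (simp only: flip: combination3_xor, simp)
  qed
qed

text \<open>Linear independence over the field with two elements: each condition says that one of
  the seven nontrivial combinations is nonempty.\<close>

definition independent :: "nat set \<Rightarrow> nat set \<Rightarrow> nat set \<Rightarrow> bool" where
  "independent \<alpha> \<beta> \<gamma> \<longleftrightarrow>
     \<alpha> \<noteq> {} \<and> \<beta> \<noteq> {} \<and> \<gamma> \<noteq> {} \<and> \<alpha> \<noteq> \<beta> \<and> \<alpha> \<noteq> \<gamma> \<and> \<beta> \<noteq> \<gamma> \<and> \<alpha> \<triangle> \<beta> \<noteq> \<gamma>"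

lemma symdiff_eq_swap: "\<alpha> \<triangle> \<beta> = \<gamma> \<longleftrightarrow> \<alpha> = \<beta> \<triangle> \<gamma>"
  by (auto simp: symdiff_def)

text \<open>The sign at \<open>(True, True)\<close> makes the third pure element equal to the
  product of the first two.\<close>

lemma indexed_basis_combination2:
  assumes "\<alpha> \<subseteq> {1..n}" "\<beta> \<subseteq> {1..n}" "\<alpha> \<noteq> {}" "\<beta> \<noteq> {}" "\<alpha> \<noteq> \<beta>"
  shows "indexed_basis n xor2 (combination2 \<alpha> \<beta>)
    (\<lambda>v. if v = (True, True) then mult_sign n \<alpha> \<beta> else 1)"
proof (rule indexed_basisI)
  fix v w
  show "combination2 \<alpha> \<beta> (xor2 v w) = combination2 \<alpha> \<beta> v \<triangle> combination2 \<alpha> \<beta> w"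
    by (rule combination2_xor)
  show "v = w" if "xor2 v w = (False, False)"
    using that by (cases v; cases w) simp
  show "v = (False, False)" if "combination2 \<alpha> \<beta> v = {}"
    using that assms by (cases v) (simp split: if_splits)
  show "combination2 \<alpha> \<beta> v \<subseteq> {1..n}"
    using assms by (cases v) (simp add: symdiff_subset)
qed simp

lemma indexed_basis_combination3:
  assumes "\<alpha> \<subseteq> {1..n}" "\<beta> \<subseteq> {1..n}" "\<gamma> \<subseteq> {1..n}" "independent \<alpha> \<beta> \<gamma>"
    and "\<And>v. \<epsilon> v * \<epsilon> v = 1"
  shows "indexed_basis n xor3 (combination3 \<alpha> \<beta> \<gamma>) \<epsilon>"
proof (rule indexed_basisI)
  fix v w
  show "combination3 \<alpha> \<beta> \<gamma> (xor3 v w) = combination3 \<alpha> \<beta> \<gamma> v \<triangle> combination3 \<alpha> \<beta> \<gamma> w"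
    by (rule combination3_xor)
  show "v = w" if "xor3 v w = (False, False, False)"
    using that by (cases v; cases w) simp
  show "v = (False, False, False)" if "combination3 \<alpha> \<beta> \<gamma> v = {}"
    using that assms(4)
    by (cases v) (simp add: independent_def symdiff_eq_swap[of \<alpha> \<beta>] split: if_splits)
  show "combination3 \<alpha> \<beta> \<gamma> v \<subseteq> {1..n}"
    using assms by (cases v) (simp add: symdiff_subset)
qed (rule assms)

text \<open>The seven hypotheses pick one pair of points on each line of the Fano plane.\<close>

lemma all_lines3:
  assumes sym: "\<And>v w. D v w \<Longrightarrow> D w v" and rotate: "\<And>v w. D v w \<Longrightarrow> D v (xor3 v w)"
    and zero: "\<And>v. D v (False, False, False)"
    and lines: "D (True, False, False) (False, True, False)" "D (True, False, False) (False, False, True)"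
      "D (False, True, False) (False, False, True)" "D (True, True, False) (False, False, True)"
      "D (True, False, False) (False, True, True)" "D (False, True, False) (True, False, True)"
      "D (True, True, False) (True, False, True)"
  shows "D v w"
proof -
  have line: "D v w \<and> D w v \<and> D v (xor3 v w) \<and> D (xor3 v w) v \<and> D w (xor3 v w) \<and> D (xor3 v w) w"
    if "D v w" for v w
  proof -
    have "xor3 w v = xor3 v w" by (cases v; cases w) auto
    then show ?thesis using that sym rotate by metis
  qed
  have "D v v" for v
    using rotate[OF zero[of v]] by (cases v) simp
  \<comment> \<open>Of the 64 pairs, 15 contain zero and 7 are diagonal and nonzero; the other 42
    are the six ordered pairs on each of the seven lines.\<close>
  then have "\<forall>a b c a' b' c'. D (a, b, c) (a', b', c')"
    unfolding all_bool_eq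
    using zero sym[OF zero] lines[THEN line] by simp
  then show ?thesis by (cases v; cases w) blast
qed

lemma all_lines2:
  assumes sym: "\<And>v w. D v w \<Longrightarrow> D w v" and rotate: "\<And>v w. D v w \<Longrightarrow> D v (xor2 v w)"
    and zero: "\<And>v. D v (False, False)" and line: "D (True, False) (False, True)"
  shows "D v w"
proof -
  have "D v v" for v
    using rotate[OF zero[of v]] by (cases v) simp
  then have "\<forall>a b a' b'. D (a, b) (a', b')"
    unfolding all_bool_eq
    using zero sym[OF zero] line sym[OF line] rotate[OF line] sym[OF rotate[OF line]]
      rotate[OF sym[OF line]] sym[OF rotate[OF sym[OF line]]] by simp
  then show ?thesis by (cases v; cases w) blast
qed

text \<open>
  The signs of the three lines that remain after the basis elements are rescaled to
  \<open>x\<close>, \<open>y\<close>, \<open>z\<close>, \<open>xy\<close>, \<open>xz\<close>, \<open>yz\<close>, \<open>(xy)z\<close>: they compare \<open>x(yz)\<close> and \<open>y(xz)\<close> with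
  \<open>(xy)z\<close>, and \<open>(xy)(xz)\<close> with \<open>yz\<close>.
\<close>

definition triple_signs :: "nat \<Rightarrow> nat set \<Rightarrow> nat set \<Rightarrow> nat set \<Rightarrow> real \<times> real \<times> real" where
  "triple_signs n \<alpha> \<beta> \<gamma> =
    (let s = mult_sign n; p = s \<alpha> \<beta> * s (\<alpha> \<triangle> \<beta>) \<gamma> in
     (s \<alpha> (\<beta> \<triangle> \<gamma>) * s \<beta> \<gamma> * p,
      s \<beta> (\<alpha> \<triangle> \<gamma>) * s \<alpha> \<gamma> * p,
      s (\<alpha> \<triangle> \<beta>) (\<alpha> \<triangle> \<gamma>) * s \<alpha> \<beta> * s \<alpha> \<gamma> * s \<beta> \<gamma>))"

text \<open>With these signs the elements labelled by two or three bits are exactly xy, xz, yz and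
  (xy)z, so the twist is 1 on the four lines that define them.\<close>

fun normalizer3 :: "nat \<Rightarrow> nat set \<Rightarrow> nat set \<Rightarrow> nat set \<Rightarrow> bool \<times> bool \<times> bool \<Rightarrow> real" where
  "normalizer3 n \<alpha> \<beta> \<gamma> (a, b, c) =
    (if a \<and> b \<and> c then mult_sign n \<alpha> \<beta> * mult_sign n (\<alpha> \<triangle> \<beta>) \<gamma>
     else if a \<and> b then mult_sign n \<alpha> \<beta>
     else if a \<and> c then mult_sign n \<alpha> \<gamma>
     else if b \<and> c then mult_sign n \<beta> \<gamma> else 1)"

lemma normalizer3_square: "normalizer3 n \<alpha> \<beta> \<gamma> v * normalizer3 n \<alpha> \<beta> \<gamma> v = 1"
  using mult_sign_pm1[of n \<alpha> \<beta>] mult_sign_pm1[of n "\<alpha> \<triangle> \<beta>" \<gamma>]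
  by (cases v) auto

text \<open>After normalization the twist is 1 on four lines, and the components of
  \<open>triple_signs\<close> are its values on the other three. Equal signs therefore agree on
  every line, whatever the heights \<open>n\<close> and \<open>n'\<close>.\<close>

lemma isomorphic_triples:
  assumes sub: "\<alpha> \<subseteq> {1..n}" "\<beta> \<subseteq> {1..n}" "\<gamma> \<subseteq> {1..n}" "independent \<alpha> \<beta> \<gamma>"
    and sub': "\<alpha>' \<subseteq> {1..n'}" "\<beta>' \<subseteq> {1..n'}" "\<gamma>' \<subseteq> {1..n'}" "independent \<alpha>' \<beta>' \<gamma>'"
    and signs: "triple_signs n \<alpha> \<beta> \<gamma> = triple_signs n' \<alpha>' \<beta>' \<gamma>'"
  shows "isomorphic (basis_span n (range (combination3 \<alpha> \<beta> \<gamma>)))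
    (basis_span n' (range (combination3 \<alpha>' \<beta>' \<gamma>')))"
proof (rule indexed_basis_isomorphic)
  let ?\<phi> = "combination3 \<alpha> \<beta> \<gamma>" and ?\<phi>' = "combination3 \<alpha>' \<beta>' \<gamma>'"
  let ?\<epsilon> = "normalizer3 n \<alpha> \<beta> \<gamma>" and ?\<epsilon>' = "normalizer3 n' \<alpha>' \<beta>' \<gamma>'"
  show B: "indexed_basis n xor3 ?\<phi> ?\<epsilon>" and B': "indexed_basis n' xor3 ?\<phi>' ?\<epsilon>'"
    using assms by (auto intro!: indexed_basis_combination3 normalizer3_square)
  interpret B: indexed_basis n xor3 ?\<phi> ?\<epsilon> by (rule B)
  interpret B': indexed_basis n' xor3 ?\<phi>' ?\<epsilon>' by (rule B')
  have zero: "?\<phi> v = {} \<longleftrightarrow> ?\<phi>' v = {}" for v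
    by (simp only: B.zero_iff B'.zero_iff)
  fix v w
  show "B.twist v w = B'.twist v w"
  proof (rule all_lines3[where D = "\<lambda>v w. B.twist v w = B'.twist v w"])
    show "B.twist w v = B'.twist w v" if "B.twist v w = B'.twist v w" for v w
      using that by (simp add: B.twist_swap[of w v] B'.twist_swap[of w v] zero)
    show "B.twist v (xor3 v w) = B'.twist v (xor3 v w)" if "B.twist v w = B'.twist v w" for v w
      using that by (simp add: B.twist_rotate B'.twist_rotate conj_sign_def zero)
    show "B.twist v (False, False, False) = B'.twist v (False, False, False)" for v
      by (simp add: B.twist_zero B'.twist_zero)
  qed (use signs in \<open>simp_all add: B.twist_def B'.twist_def triple_signs_def Let_def mult_ac\<close>)
qed

text \<open>There is one line only, and rescaling makes its twist 1, so no invariant is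
  left.\<close>

lemma isomorphic_pairs:
  assumes sub: "\<alpha> \<subseteq> {1..n}" "\<beta> \<subseteq> {1..n}" "\<alpha> \<noteq> {}" "\<beta> \<noteq> {}" "\<alpha> \<noteq> \<beta>"
    and sub': "\<alpha>' \<subseteq> {1..n'}" "\<beta>' \<subseteq> {1..n'}" "\<alpha>' \<noteq> {}" "\<beta>' \<noteq> {}" "\<alpha>' \<noteq> \<beta>'"
  shows "isomorphic (basis_span n (range (combination2 \<alpha> \<beta>)))
    (basis_span n' (range (combination2 \<alpha>' \<beta>')))"
proof (rule indexed_basis_isomorphic)
  let ?\<phi> = "combination2 \<alpha> \<beta>" and ?\<phi>' = "combination2 \<alpha>' \<beta>'"
  let ?\<epsilon> = "\<lambda>v. if v = (True, True) then mult_sign n \<alpha> \<beta> else 1"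
  let ?\<epsilon>' = "\<lambda>v. if v = (True, True) then mult_sign n' \<alpha>' \<beta>' else 1"
  show B: "indexed_basis n xor2 ?\<phi> ?\<epsilon>" and B': "indexed_basis n' xor2 ?\<phi>' ?\<epsilon>'"
    using assms by (auto intro!: indexed_basis_combination2)
  interpret B: indexed_basis n xor2 ?\<phi> ?\<epsilon> by (rule B)
  interpret B': indexed_basis n' xor2 ?\<phi>' ?\<epsilon>' by (rule B')
  have zero: "?\<phi> v = {} \<longleftrightarrow> ?\<phi>' v = {}" for v
    by (simp only: B.zero_iff B'.zero_iff)
  fix v w
  show "B.twist v w = B'.twist v w"
  proof (rule all_lines2[where D = "\<lambda>v w. B.twist v w = B'.twist v w"])
    show "B.twist w v = B'.twist w v" if "B.twist v w = B'.twist v w" for v w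
      using that by (simp add: B.twist_swap[of w v] B'.twist_swap[of w v] zero)
    show "B.twist v (xor2 v w) = B'.twist v (xor2 v w)" if "B.twist v w = B'.twist v w" for v w
      using that by (simp add: B.twist_rotate B'.twist_rotate conj_sign_def zero)
    show "B.twist v (False, False) = B'.twist v (False, False)" for v
      by (simp add: B.twist_zero B'.twist_zero)
  qed (simp_all add: B.twist_def B'.twist_def)
qed

subsection \<open>Change of generating triple\<close>

text \<open>An elementary operation on generators; composing such operations shows that the
  exchanged triples generate the same group.\<close>

lemma symdiff_closure_insert_symdiff:
  assumes "\<beta> \<in> K"
  shows "symdiff_closure (insert (\<alpha> \<triangle> \<beta>) K) = symdiff_closure (insert \<alpha> K)"
proof
  have "\<alpha> \<triangle> \<beta> \<in> symdiff_closure (insert \<alpha> K)"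
    using assms by (intro symdiff_closure.symdiff symdiff_closure.generator) simp_all
  then show "symdiff_closure (insert (\<alpha> \<triangle> \<beta>) K) \<subseteq> symdiff_closure (insert \<alpha> K)"
    by (intro symdiff_closure_subset)
      (auto simp: symdiff_closure.generator symdiff_closure.empty symdiff_closure.symdiff)
  have "(\<alpha> \<triangle> \<beta>) \<triangle> \<beta> \<in> symdiff_closure (insert (\<alpha> \<triangle> \<beta>) K)"
    using assms by (intro symdiff_closure.symdiff symdiff_closure.generator) simp_all
  then have "\<alpha> \<in> symdiff_closure (insert (\<alpha> \<triangle> \<beta>) K)"
    by (simp add: symdiff.assoc)
  then show "symdiff_closure (insert \<alpha> K) \<subseteq> symdiff_closure (insert (\<alpha> \<triangle> \<beta>) K)"
    by (intro symdiff_closure_subset)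
      (auto simp: symdiff_closure.generator symdiff_closure.empty symdiff_closure.symdiff)
qed

text \<open>The three points of a line multiply cyclically, as the quaternion units do. Naming the
  third point \<gamma> turns these equations into rewrite rules that leave one sign per
  line.\<close>

lemma mult_sign_line:
  assumes "\<alpha> \<subseteq> {1..n}" "\<beta> \<subseteq> {1..n}" "\<alpha> \<noteq> {}" "\<beta> \<noteq> {}" "\<alpha> \<noteq> \<beta>" and "\<gamma> = \<alpha> \<triangle> \<beta>"
  shows "\<alpha> \<triangle> \<beta> = \<gamma>" "\<beta> \<triangle> \<alpha> = \<gamma>" "\<alpha> \<triangle> \<gamma> = \<beta>" "\<gamma> \<triangle> \<alpha> = \<beta>" "\<beta> \<triangle> \<gamma> = \<alpha>" "\<gamma> \<triangle> \<beta> = \<alpha>"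
    and "mult_sign n \<beta> \<alpha> = - mult_sign n \<alpha> \<beta>"
    and "mult_sign n \<alpha> \<gamma> = - mult_sign n \<alpha> \<beta>" "mult_sign n \<gamma> \<alpha> = mult_sign n \<alpha> \<beta>"
    and "mult_sign n \<beta> \<gamma> = mult_sign n \<alpha> \<beta>" "mult_sign n \<gamma> \<beta> = - mult_sign n \<alpha> \<beta>"
proof -
  show "\<alpha> \<triangle> \<beta> = \<gamma>" "\<beta> \<triangle> \<alpha> = \<gamma>" "\<alpha> \<triangle> \<gamma> = \<beta>" "\<gamma> \<triangle> \<alpha> = \<beta>" "\<beta> \<triangle> \<gamma> = \<alpha>" "\<gamma> \<triangle> \<beta> = \<alpha>"
    unfolding assms(6) by (auto simp: symdiff_def)
  show anti: "mult_sign n \<beta> \<alpha> = - mult_sign n \<alpha> \<beta>"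
    using assms by (intro mult_sign_anticommute)
  have eqI: "s = - t" if "t * s = -1" "t = 1 \<or> t = -1" for s t :: real
    using that by auto
  have \<gamma>: "\<beta> \<triangle> \<alpha> = \<gamma>" by fact
  have c: "conj_sign \<alpha> = -1" "conj_sign \<beta> = -1"
    using assms by (simp_all add: conj_sign_def)
  note alt1 = mult_sign_alternative[OF assms(1,2), folded assms(6), unfolded c]
  note alt2 = mult_sign_alternative[OF assms(2,1), unfolded \<gamma> c]
  show "mult_sign n \<alpha> \<gamma> = - mult_sign n \<alpha> \<beta>"
    by (rule eqI[OF conjunct1[OF alt1] mult_sign_pm1])
  show "mult_sign n \<gamma> \<alpha> = mult_sign n \<alpha> \<beta>"
    using eqI[of "mult_sign n \<beta> \<alpha>" "mult_sign n \<gamma> \<alpha>"] alt1 mult_sign_pm1[of n \<beta> \<alpha>] anti by simp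
  show "mult_sign n \<beta> \<gamma> = mult_sign n \<alpha> \<beta>"
    using eqI[of "mult_sign n \<beta> \<alpha>" "mult_sign n \<beta> \<gamma>"] alt2 mult_sign_pm1[of n \<beta> \<alpha>] anti by simp
  show "mult_sign n \<gamma> \<beta> = - mult_sign n \<alpha> \<beta>"
    by (rule eqI[OF conjunct2[OF alt2] mult_sign_pm1])
qed

text \<open>The candidate triples move the reversed line to the place it has for \<open>P4\<close>.\<close>

lemma normal_triple:
  assumes sub: "\<alpha> \<subseteq> {1..n}" "\<beta> \<subseteq> {1..n}" "\<gamma> \<subseteq> {1..n}" and ind: "independent \<alpha> \<beta> \<gamma>"
  obtains \<alpha>' \<beta>' \<gamma>' where
    "\<alpha>' \<subseteq> {1..n}" "\<beta>' \<subseteq> {1..n}" "\<gamma>' \<subseteq> {1..n}" "independent \<alpha>' \<beta>' \<gamma>'"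
    "symdiff_closure {\<alpha>', \<beta>', \<gamma>'} = symdiff_closure {\<alpha>, \<beta>, \<gamma>}"
    "triple_signs n \<alpha>' \<beta>' \<gamma>' \<in> {(-1, 1, -1), (1, -1, 1)}"
proof -
  \<comment> \<open>Together with \<alpha>, \<beta> and \<gamma> these are the seven points of the
    plane; \<open>L1\<close> to \<open>L7\<close> below are its lines.\<close>
  define p q r t where "p = \<alpha> \<triangle> \<beta>" "q = \<alpha> \<triangle> \<gamma>" "r = \<beta> \<triangle> \<gamma>" "t = p \<triangle> \<gamma>"
  note defs = this
  have t: "t = \<alpha> \<triangle> r" "t = \<beta> \<triangle> q"
    unfolding defs by (auto simp: symdiff_def)
  have r: "r = p \<triangle> q"
    unfolding defs by (auto simp: symdiff_def)
  have sub': "p \<subseteq> {1..n}" "q \<subseteq> {1..n}" "r \<subseteq> {1..n}"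
    unfolding defs using sub by (simp_all add: symdiff_subset)
  have neq: "\<alpha> \<noteq> {}" "\<beta> \<noteq> {}" "\<gamma> \<noteq> {}" "\<alpha> \<noteq> \<beta>" "\<alpha> \<noteq> \<gamma>" "\<beta> \<noteq> \<gamma>" "p \<noteq> \<gamma>"
    using ind by (simp_all add: independent_def defs(1))
  have neq_p: "p \<noteq> {}" "p \<noteq> \<alpha>" "p \<noteq> \<beta>" and neq_q: "q \<noteq> {}" "q \<noteq> \<alpha>" "q \<noteq> \<gamma>"
    and neq_r: "r \<noteq> {}" "r \<noteq> \<beta>" "r \<noteq> \<gamma>" and "p \<noteq> q"
    using neq(1-6) by (simp_all add: defs(1-3))
  have "t \<noteq> {}" using neq by (simp add: defs(4))
  then have "\<alpha> \<noteq> r" "\<beta> \<noteq> q" using t by auto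
  have "t \<noteq> \<alpha>" using neq_r(1) by (simp add: t(1))
  have "t \<noteq> \<beta>" using neq_q(1) by (simp add: t(2))
  note L1 = mult_sign_line[OF sub(1,2) neq(1,2,4) defs(1)]
  note L2 = mult_sign_line[OF sub(1,3) neq(1,3,5) defs(2)]
  note L3 = mult_sign_line[OF sub(2,3) neq(2,3,6) defs(3)]
  note L4 = mult_sign_line[OF sub'(1) sub(3) neq_p(1) neq(3,7) defs(4)]
  note L5 = mult_sign_line[OF sub(1) sub'(3) neq(1) neq_r(1) \<open>\<alpha> \<noteq> r\<close> t(1)]
  note L6 = mult_sign_line[OF sub(2) sub'(2) neq(2) neq_q(1) \<open>\<beta> \<noteq> q\<close> t(2)]
  note L7 = mult_sign_line[OF sub'(1,2) neq_p(1) neq_q(1) \<open>p \<noteq> q\<close> r]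
  note lines = L1 L2 L3 L4 L5 L6 L7
  note pm1 = mult_sign_pm1[of n \<alpha> \<beta>] mult_sign_pm1[of n \<alpha> \<gamma>] mult_sign_pm1[of n \<beta> \<gamma>]
    mult_sign_pm1[of n p \<gamma>] mult_sign_pm1[of n \<alpha> r] mult_sign_pm1[of n \<beta> q] mult_sign_pm1[of n p q]
  have swap: "symdiff_closure {\<alpha>, \<gamma>, \<beta>} = symdiff_closure {\<alpha>, \<beta>, \<gamma>}"
    "symdiff_closure {\<beta>, \<gamma>, \<alpha>} = symdiff_closure {\<alpha>, \<beta>, \<gamma>}"
    by (simp_all add: insert_commute)
  have shear: "symdiff_closure {\<alpha>, r, \<beta>} = symdiff_closure {\<alpha>, \<beta>, \<gamma>}"
    "symdiff_closure {p, q, \<alpha>} = symdiff_closure {\<alpha>, \<beta>, \<gamma>}"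
    "symdiff_closure {p, \<gamma>, \<alpha>} = symdiff_closure {\<alpha>, \<beta>, \<gamma>}"
    "symdiff_closure {q, \<beta>, \<alpha>} = symdiff_closure {\<alpha>, \<beta>, \<gamma>}"
    using symdiff_closure_insert_symdiff[of \<beta> "{\<alpha>, \<beta>}" \<gamma>]
      symdiff_closure_insert_symdiff[of \<alpha> "{q, \<alpha>}" \<beta>] symdiff_closure_insert_symdiff[of \<alpha> "{\<beta>, \<alpha>}" \<gamma>]
      symdiff_closure_insert_symdiff[of \<alpha> "{\<gamma>, \<alpha>}" \<beta>]
    by (simp_all add: lines insert_commute)
  let ?N = "{(-1, 1, -1), (1, -1, 1)} :: (real \<times> real \<times> real) set"
  \<comment> \<open>The first two entries of the seven triples lie on seven different lines. If one
    line is reversed relative to \<open>O\<close>, the triple starting on it has the signs of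
    \<open>P4\<close>; if none is, the triples have the signs of \<open>O\<close>. The claim is
    checked for all assignments of signs to the seven lines.\<close>
  have "triple_signs n \<alpha> \<beta> \<gamma> \<in> ?N \<or> triple_signs n \<alpha> \<gamma> \<beta> \<in> ?N \<or> triple_signs n \<beta> \<gamma> \<alpha> \<in> ?N \<or>
    triple_signs n \<alpha> r \<beta> \<in> ?N \<or> triple_signs n p q \<alpha> \<in> ?N \<or> triple_signs n p \<gamma> \<alpha> \<in> ?N \<or>
    triple_signs n q \<beta> \<alpha> \<in> ?N"
    unfolding triple_signs_def Let_def lines using pm1 by (elim disjE) simp_all
  moreover have "independent \<alpha> \<gamma> \<beta>" "independent \<beta> \<gamma> \<alpha>" "independent \<alpha> r \<beta>" "independent p q \<alpha>"
    "independent p \<gamma> \<alpha>" "independent q \<beta> \<alpha>"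
    unfolding independent_def lines
    using neq neq_p neq_q neq_r \<open>\<alpha> \<noteq> r\<close> \<open>\<beta> \<noteq> q\<close> \<open>p \<noteq> q\<close> \<open>t \<noteq> \<alpha>\<close> \<open>t \<noteq> \<beta>\<close>
    by (simp_all add: eq_commute)
  ultimately show ?thesis
    using that[OF sub ind refl] that[of \<alpha> \<gamma> \<beta>] that[of \<beta> \<gamma> \<alpha>] that[of \<alpha> r \<beta>] that[of p q \<alpha>]
      that[of p \<gamma> \<alpha>] that[of q \<beta> \<alpha>] swap shear sub sub' by blast
qed

subsection \<open>Triads\<close>

text \<open>Singletons form a basis of the power set over the field with two elements. This presents
  the full algebras \<open>H\<close> and \<open>O\<close> as spans of combinations.\<close>

lemma Pow_eq_symdiff_closure:
  assumes "finite A"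
  shows "Pow A = symdiff_closure ((\<lambda>k. {k}) ` A)"
proof
  have "B \<in> symdiff_closure ((\<lambda>k. {k}) ` A)" if "B \<subseteq> A" for B
    using finite_subset[OF that assms] that
  proof (induction B rule: finite_induct)
    case (insert k B)
    have "insert k B = {k} \<triangle> B" using insert.hyps by (auto simp: symdiff_def)
    moreover have "{k} \<in> symdiff_closure ((\<lambda>k. {k}) ` A)" "B \<in> symdiff_closure ((\<lambda>k. {k}) ` A)"
      using insert by (auto intro: symdiff_closure.generator)
    ultimately show ?case
      by (simp only: symdiff_closure.symdiff)
  qed (rule symdiff_closure.empty)
  then show "Pow A \<subseteq> symdiff_closure ((\<lambda>k. {k}) ` A)" by blast
  show "symdiff_closure ((\<lambda>k. {k}) ` A) \<subseteq> Pow A"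
    by (rule symdiff_closure_subset) (auto simp: symdiff_def)
qed

lemma alg_H_eq: "alg_H = basis_span 2 (range (combination2 {1} {2}))"
proof -
  have "{1..2} = {1, 2 :: nat}" by auto
  then have "Pow {1..2} = symdiff_closure {{1}, {2}}"
    using Pow_eq_symdiff_closure[of "{1..2}"] by simp
  then show ?thesis
    by (simp add: alg_H_def cd_algebra_eq_basis_span symdiff_closure_pair[of "{1}" _ "{2}"])
qed

lemma alg_O_eq: "alg_O = basis_span 3 (range (combination3 {1} {2} {3}))"
proof -
  have "{1..3} = {1, 2, 3 :: nat}" by auto
  then have "Pow {1..3} = symdiff_closure {{1}, {2}, {3}}"
    using Pow_eq_symdiff_closure[of "{1..3}"] by simp
  then show ?thesis
    by (simp add: alg_O_def cd_algebra_eq_basis_span symdiff_closure_triple)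
qed

lemma cd_generated_pair:
  assumes "\<alpha> \<subseteq> {1..n}" "\<beta> \<subseteq> {1..n}" "\<alpha> \<noteq> {}"
  shows "cd_generated n {cd_basis n \<alpha>, cd_basis n \<beta>, cd_basis n (\<alpha> \<triangle> \<beta>)} =
    basis_span n (range (combination2 \<alpha> \<beta>))"
  using cd_generated_basis[of "{\<alpha>, \<beta>, \<alpha> \<triangle> \<beta>}" n \<alpha>] assms
  by (simp add: symdiff_subset symdiff_closure_pair[of \<alpha> _ \<beta>])

lemma cd_generated_triple:
  assumes "\<alpha> \<subseteq> {1..n}" "\<beta> \<subseteq> {1..n}" "\<gamma> \<subseteq> {1..n}" "\<alpha> \<noteq> {}"
  shows "cd_generated n {cd_basis n \<alpha>, cd_basis n \<beta>, cd_basis n \<gamma>} =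
    basis_span n (range (combination3 \<alpha> \<beta> \<gamma>))"
  using cd_generated_basis[of "{\<alpha>, \<beta>, \<gamma>}" n \<alpha>] assms
  by (simp add: symdiff_closure_triple)

lemma alg_P4_eq: "alg_P4 = basis_span 4 (range (combination3 {1} {2} {3, 4}))"
  unfolding alg_P4_def by (simp add: cd_generated_triple)

lemma alg_P12_eq: "alg_P12 = basis_span 5 (range (combination3 {1} {2, 4} {3, 4, 5}))"
  unfolding alg_P12_def by (simp add: cd_generated_triple)

lemma alg_P14_eq: "alg_P14 = basis_span 6 (range (combination3 {1, 4} {2, 5} {3, 6}))"
  unfolding alg_P14_def by (simp add: cd_generated_triple)

section \<open>Signs of the model triples and independence of the height\<close>

text \<open>Reduces equality of enumerated sets to membership tests between numerals, which
  simplification decides.\<close>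

lemma insert_eq_insert:
  "insert a A = insert b B \<longleftrightarrow> insert a A \<subseteq> insert b B \<and> insert b B \<subseteq> insert a A"
  by (rule set_eq_subset)

lemma independent_examples:
  "independent {1} {2} {3}" "independent {1} {2} {3, 4}"
  "independent {1} {2, 4} {3, 4, 5}" "independent {1, 4} {2, 5} {3, 6}"
  by (simp_all add: independent_def symdiff_def insert_Diff_if insert_eq_insert)

text \<open>Both values come from evaluating the doubling recursion. They differ in all three
  components, the effect of reversing the line through the first two points, whose sign enters each
  component once.\<close>

lemma triple_signs_O: "triple_signs 3 {1} {2} {3} = (-1, 1, -1)"
  and triple_signs_P4: "triple_signs 4 {1} {2} {3, 4} = (1, -1, 1)"
  by (simp_all add: triple_signs_def symdiff_def insert_Diff_if mult_sign.simps(2) Let_def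
      conj_sign_def One_nat_def eval_nat_numeral)

text \<open>The embedding of an algebra as the first component of its double is
  multiplicative.\<close>

lemma mult_sign_mono:
  assumes "k \<le> n" "\<alpha> \<subseteq> {1..k}" "\<beta> \<subseteq> {1..k}"
  shows "mult_sign n \<alpha> \<beta> = mult_sign k \<alpha> \<beta>"
  using assms(1)
proof (induction n rule: dec_induct)
  case (step n)
  then have "{1..k} \<subseteq> {1..n}" by auto
  then have "\<alpha> \<subseteq> {1..n}" "\<beta> \<subseteq> {1..n}" using assms by blast+
  with step show ?case by (simp add: mult_sign_Suc)
qed simp

lemma triple_signs_mono:
  assumes "k \<le> n" "\<alpha> \<subseteq> {1..k}" "\<beta> \<subseteq> {1..k}" "\<gamma> \<subseteq> {1..k}"
  shows "triple_signs n \<alpha> \<beta> \<gamma> = triple_signs k \<alpha> \<beta> \<gamma>"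
  using assms by (simp add: triple_signs_def Let_def mult_sign_mono symdiff_subset)

text \<open>This is \<open>isomorphic_triples\<close> for one triple at two heights; it carries the
  model triples to every larger algebra.\<close>

lemma isomorphic_generated_level:
  assumes "k \<le> n" "\<alpha> \<subseteq> {1..k}" "\<beta> \<subseteq> {1..k}" "\<gamma> \<subseteq> {1..k}" "independent \<alpha> \<beta> \<gamma>"
  shows "isomorphic (cd_generated n {cd_basis n \<alpha>, cd_basis n \<beta>, cd_basis n \<gamma>})
    (basis_span k (range (combination3 \<alpha> \<beta> \<gamma>)))"
proof -
  have "{1..k} \<subseteq> {1..n}" using assms(1) by auto
  then have "\<alpha> \<subseteq> {1..n}" "\<beta> \<subseteq> {1..n}" "\<gamma> \<subseteq> {1..n}" using assms by blast+
  then show ?thesis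
    using assms isomorphic_triples[of \<alpha> n \<beta> \<gamma> \<alpha> k \<beta> \<gamma>] triple_signs_mono[OF assms(1-4)]
    by (simp add: cd_generated_triple independent_def)
qed

lemma isomorphic_generated:
  assumes sub: "\<alpha> \<subseteq> {1..n}" "\<beta> \<subseteq> {1..n}" "\<gamma> \<subseteq> {1..n}"
    and neq: "\<alpha> \<noteq> {}" "\<beta> \<noteq> {}" "\<gamma> \<noteq> {}" "\<alpha> \<noteq> \<beta>" "\<alpha> \<noteq> \<gamma>" "\<beta> \<noteq> \<gamma>"
  shows "\<exists>X\<in>{alg_H, alg_O, alg_P4}.
    isomorphic (cd_generated n {cd_basis n \<alpha>, cd_basis n \<beta>, cd_basis n \<gamma>}) X"
proof (cases "\<gamma> = \<alpha> \<triangle> \<beta>")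
  case True
  then have "isomorphic (cd_generated n {cd_basis n \<alpha>, cd_basis n \<beta>, cd_basis n \<gamma>}) alg_H"
    using sub neq by (simp add: cd_generated_pair alg_H_eq isomorphic_pairs)
  then show ?thesis by blast
next
  case False
  then have "independent \<alpha> \<beta> \<gamma>" using neq by (auto simp: independent_def)
  from normal_triple[OF sub this] obtain \<alpha>' \<beta>' \<gamma>' where
    triple: "\<alpha>' \<subseteq> {1..n}" "\<beta>' \<subseteq> {1..n}" "\<gamma>' \<subseteq> {1..n}" "independent \<alpha>' \<beta>' \<gamma>'"
    and closure: "symdiff_closure {\<alpha>', \<beta>', \<gamma>'} = symdiff_closure {\<alpha>, \<beta>, \<gamma>}"
    and signs: "triple_signs n \<alpha>' \<beta>' \<gamma>' \<in> {(-1, 1, -1), (1, -1, 1)}"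
    by metis
  \<comment> \<open>The generated algebra depends only on the closure of the index sets, so the
    normalized triple may replace the given one.\<close>
  have eq: "cd_generated n {cd_basis n \<alpha>, cd_basis n \<beta>, cd_basis n \<gamma>} =
      basis_span n (range (combination3 \<alpha>' \<beta>' \<gamma>'))"
    using sub neq closure by (simp add: cd_generated_triple symdiff_closure_triple)
  have *: "isomorphic (basis_span n (range (combination3 \<alpha>' \<beta>' \<gamma>'))) alg_O"
    if "triple_signs n \<alpha>' \<beta>' \<gamma>' = (-1, 1, -1)"
    unfolding alg_O_eq using that
    by (intro isomorphic_triples triple independent_examples) (simp_all add: triple_signs_O)
  have "isomorphic (basis_span n (range (combination3 \<alpha>' \<beta>' \<gamma>'))) alg_P4"
    if "triple_signs n \<alpha>' \<beta>' \<gamma>' = (1, -1, 1)"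
    unfolding alg_P4_eq using that
    by (intro isomorphic_triples triple independent_examples) (simp_all add: triple_signs_P4)
  with * signs show ?thesis
    unfolding eq by auto
qed

section \<open>The order on basis elements, and triads as triples of index sets\<close>

text \<open>The largest element of the symmetric difference cannot lie in both sets. In a triad this
  separates the first member from the third without transitivity.\<close>

lemma index_less_asym:
  assumes "index_less \<alpha> \<beta>" "finite \<alpha>" "finite \<beta>"
  shows "\<not> index_less \<beta> \<alpha>"
proof
  assume "index_less \<beta> \<alpha>"
  let ?D = "(\<alpha> - \<beta>) \<union> (\<beta> - \<alpha>)"
  have "Max ?D \<in> ?D"
    using assms by (intro Max_in) (auto simp: index_less_def)
  moreover have "Max ?D \<in> \<beta>" "Max ?D \<in> \<alpha>"
    using assms \<open>index_less \<beta> \<alpha>\<close> by (simp_all add: index_less_def Un_commute)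
  ultimately show False by blast
qed

lemma cd_basis_inject:
  assumes "\<alpha> \<subseteq> {1..n}" "\<beta> \<subseteq> {1..n}" "cd_basis n \<alpha> = cd_basis n \<beta>"
  shows "\<alpha> = \<beta>"
  using assms by (auto simp: cd_basis_of_coords of_coords_eq_iff split: if_splits)

lemma cd_basis_less_iff:
  assumes "\<alpha> \<subseteq> {1..n}" "\<beta> \<subseteq> {1..n}"
  shows "cd_basis_less n (cd_basis n \<alpha>) (cd_basis n \<beta>) \<longleftrightarrow> index_less \<alpha> \<beta>"
proof
  assume "cd_basis_less n (cd_basis n \<alpha>) (cd_basis n \<beta>)"
  then obtain \<alpha>' \<beta>' where "\<alpha>' \<subseteq> {1..n}" "\<beta>' \<subseteq> {1..n}"
    "cd_basis n \<alpha> = cd_basis n \<alpha>'" "cd_basis n \<beta> = cd_basis n \<beta>'" and less: "index_less \<alpha>' \<beta>'"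
    unfolding cd_basis_less_def by blast
  then have "\<alpha> = \<alpha>'" "\<beta> = \<beta>'"
    using assms by (metis cd_basis_inject)+
  with less show "index_less \<alpha> \<beta>" by simp
next
  assume "index_less \<alpha> \<beta>"
  with assms show "cd_basis_less n (cd_basis n \<alpha>) (cd_basis n \<beta>)"
    unfolding cd_basis_less_def by blast
qed

lemma triadE:
  assumes "triad n t"
  obtains \<alpha> \<beta> \<gamma> where "t = (cd_basis n \<alpha>, cd_basis n \<beta>, cd_basis n \<gamma>)"
    "\<alpha> \<subseteq> {1..n}" "\<beta> \<subseteq> {1..n}" "\<gamma> \<subseteq> {1..n}" "\<alpha> \<noteq> {}" "\<beta> \<noteq> {}" "\<gamma> \<noteq> {}" "\<alpha> \<noteq> \<beta>" "\<alpha> \<noteq> \<gamma>" "\<beta> \<noteq> \<gamma>"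
proof -
  obtain b c d where t: "t = (b, c, d)" by (cases t)
  with assms obtain \<alpha> \<beta> \<gamma> where bcd: "b = cd_basis n \<alpha>" "c = cd_basis n \<beta>" "d = cd_basis n \<gamma>"
    and sub: "\<alpha> \<subseteq> {1..n}" "\<beta> \<subseteq> {1..n}" "\<gamma> \<subseteq> {1..n}" and ne: "\<alpha> \<noteq> {}" "\<beta> \<noteq> {}" "\<gamma> \<noteq> {}"
    unfolding triad_def cd_pure_basis_def prod.case by blast
  have less: "index_less \<alpha> \<beta>" "index_less \<beta> \<gamma>"
    using assms sub by (simp_all add: triad_def t bcd cd_basis_less_iff)
  have "finite \<alpha>" "finite \<beta>" using sub by (auto intro: finite_subset)
  then have "\<alpha> \<noteq> \<gamma>" using index_less_asym[OF less(1)] less(2) by blast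
  moreover have "\<alpha> \<noteq> \<beta>" "\<beta> \<noteq> \<gamma>" using less by (auto simp: index_less_def)
  ultimately show ?thesis using that t bcd sub ne by blast
qed

lemma triadI:
  assumes "\<alpha> \<subseteq> {1..n}" "\<beta> \<subseteq> {1..n}" "\<gamma> \<subseteq> {1..n}" "\<alpha> \<noteq> {}" "\<beta> \<noteq> {}" "\<gamma> \<noteq> {}"
    "index_less \<alpha> \<beta>" "index_less \<beta> \<gamma>"
  shows "triad n (cd_basis n \<alpha>, cd_basis n \<beta>, cd_basis n \<gamma>)"
  using assms by (auto simp: triad_def cd_pure_basis_def cd_basis_less_iff)

section \<open>Triads that realize the listed algebras\<close>

lemma triad_arises:
  assumes "k \<le> n" "\<alpha> \<subseteq> {1..k}" "\<beta> \<subseteq> {1..k}" "\<gamma> \<subseteq> {1..k}" "independent \<alpha> \<beta> \<gamma>"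
    "index_less \<alpha> \<beta>" "index_less \<beta> \<gamma>"
  shows "\<exists>t. triad n t \<and>
    isomorphic (triad_algebra n t) (basis_span k (range (combination3 \<alpha> \<beta> \<gamma>)))"
proof -
  have "{1..k} \<subseteq> {1..n}" using assms(1) by auto
  then have "\<alpha> \<subseteq> {1..n}" "\<beta> \<subseteq> {1..n}" "\<gamma> \<subseteq> {1..n}" using assms by blast+
  then have "triad n (cd_basis n \<alpha>, cd_basis n \<beta>, cd_basis n \<gamma>)"
    using assms by (intro triadI) (simp_all add: independent_def)
  then show ?thesis
    using isomorphic_generated_level[OF assms(1-5)]
    by (intro exI[of _ "(cd_basis n \<alpha>, cd_basis n \<beta>, cd_basis n \<gamma>)"]) (simp add: triad_algebra_def)
qed

text \<open>The third member is, up to sign, the product of the first two, so the triad spans a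
  single line.\<close>

lemma triad_arises_H:
  assumes "2 \<le> n"
  shows "\<exists>t. triad n t \<and> isomorphic (triad_algebra n t) alg_H"
proof -
  have "{1} \<triangle> {2} = {1, 2 :: nat}" by (auto simp: symdiff_def)
  then have "isomorphic (cd_generated n {cd_basis n {1}, cd_basis n {2}, cd_basis n {1, 2}}) alg_H"
    using assms cd_generated_pair[of "{1}" n "{2}"] isomorphic_pairs[of "{1}" n "{2}" "{1}" 2 "{2}"]
    by (simp add: alg_H_eq)
  moreover have "triad n (cd_basis n {1}, cd_basis n {2}, cd_basis n {1, 2})"
    using assms by (intro triadI) (simp_all add: index_less_def insert_Diff_if)
  ultimately show ?thesis
    by (intro exI[of _ "(cd_basis n {1}, cd_basis n {2}, cd_basis n {1, 2})"]) (simp add: triad_algebra_def)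
qed

lemma triad_arises_O:
  assumes "3 \<le> n"
  shows "\<exists>t. triad n t \<and> isomorphic (triad_algebra n t) alg_O"
  unfolding alg_O_eq using assms
  by (intro triad_arises independent_examples)
    (simp_all add: index_less_def insert_Diff_if insert_eq_insert)

lemma triad_arises_P4:
  assumes "4 \<le> n"
  shows "\<exists>t. triad n t \<and> isomorphic (triad_algebra n t) alg_P4"
  unfolding alg_P4_eq using assms
  by (intro triad_arises independent_examples)
    (simp_all add: index_less_def insert_Diff_if insert_eq_insert)

lemma triad_arises_P12:
  assumes "5 \<le> n"
  shows "\<exists>t. triad n t \<and> isomorphic (triad_algebra n t) alg_P12"
  unfolding alg_P12_eq using assms
  by (intro triad_arises independent_examples)
    (simp_all add: index_less_def insert_Diff_if insert_eq_insert)

lemma triad_arises_P14: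
  assumes "6 \<le> n"
  shows "\<exists>t. triad n t \<and> isomorphic (triad_algebra n t) alg_P14"
  unfolding alg_P14_eq using assms
  by (intro triad_arises independent_examples)
    (simp_all add: index_less_def insert_Diff_if insert_eq_insert)

theorem theorem9:
  shows "(\<forall>m\<ge>1. \<forall>t. triad (U_level m) t \<longrightarrow>
            (\<exists>X \<in> {alg_H, alg_O, alg_P4, alg_P12, alg_P14}.
               isomorphic (triad_algebra (U_level m) t) X \<or>
               anti_isomorphic (triad_algebra (U_level m) t) X))
       \<and> triad_algebras_are (U_level 1) {alg_H, alg_O, alg_P4}
       \<and> triad_algebras_are (U_level 2) {alg_H, alg_O, alg_P4, alg_P12}
       \<and> (\<forall>m\<ge>3. triad_algebras_are (U_level m) {alg_H, alg_O, alg_P4, alg_P12, alg_P14})"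
proof -
  have "\<exists>X\<in>{alg_H, alg_O, alg_P4}. isomorphic (triad_algebra n t) X" if "triad n t" for n t
    using that by (rule triadE) (simp only: triad_algebra_def prod.case, rule isomorphic_generated)
  then have classify: "\<exists>X\<in>L. isomorphic (triad_algebra n t) X \<or> anti_isomorphic (triad_algebra n t) X"
    if "triad n t" "{alg_H, alg_O, alg_P4} \<subseteq> L" for n t L
    using that by blast
  \<comment> \<open>Every list contains \<open>H\<close>, \<open>O\<close> and \<open>P4\<close>, so
    the classification half is uniform in the height. Only the realization half depends on it,
    through the room that the defining triples need.\<close>
  have are: "triad_algebras_are n L"
    if "{alg_H, alg_O, alg_P4} \<subseteq> L" "\<And>X. X \<in> L \<Longrightarrow> \<exists>t. triad n t \<and> isomorphic (triad_algebra n t) X"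
    for n L
    unfolding triad_algebras_are_def using classify that by blast
  note arises = triad_arises_H triad_arises_O triad_arises_P4 triad_arises_P12 triad_arises_P14
  show ?thesis
  proof (intro conjI allI impI)
    show "triad_algebras_are (U_level 1) {alg_H, alg_O, alg_P4}"
      by (rule are, blast, elim insertE emptyE) (hypsubst, rule arises, simp)+
    show "triad_algebras_are (U_level 2) {alg_H, alg_O, alg_P4, alg_P12}"
      by (rule are, blast, elim insertE emptyE) (hypsubst, rule arises, simp)+
    show "triad_algebras_are (U_level m) {alg_H, alg_O, alg_P4, alg_P12, alg_P14}" if "m \<ge> 3" for m
      by (rule are, blast, elim insertE emptyE) (hypsubst, rule arises, use that in simp)+
  qed (rule classify, assumption, blast)
qed

end
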